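(* There is an algorithm that, given an integer $k$ and a symmetric $n\times n$ $0,1$-matrix $M$, runs in time $n^{O(1)}$ and either outputs a symmetric partition sequence of $M$ witnessing that $\mathrm{stw}(M)=O(k^3)$ (i.e., every partition in it has stretch value $O(k^3)$), or correctly reports that $\mathrm{stw}(M)>k$.
   Context: Let $M$ be a symmetric $n\times n$ $0,1$-matrix with rows $r_1,\dots,r_n$ and columns $c_1,\dots,c_n$. A symmetric partition of $M$ is a pair $(\mathcal R,\mathcal C)$ with $\mathcal R$ a partition of the rows and $\mathcal C$ a partition of the columns such that $r_i,r_j$ lie in the same part iff $c_i,c_j$ lie in the same part; each row part $R$ then has a symmetric column part. For a row part $R$ and column part $C$, the zone $R\cap C$ is the submatrix with rows $R$ and columns $C$; it is non-constant if it contains two distinct entries. A symmetric partition sequence of $M$ is a sequence $(\mathcal R_n,\mathcal C_n),\dots,(\mathcal R_1,\mathcal C_1)$ of symmetric partitions, starting with the partition into singletons, ending with one row part and one column part, each obtained from the previous one by merging two row parts and the two symmetric column parts. The span $\langle X\rangle$ of a set $X$ of columns is the set of columns with index between the minimum and maximum index in $X$; two sets conflict if their spans intersect. The stretch value of a row part $R$ is the number of column parts conflicting with the union of all column parts $C$ such that $C$ is the symmetric of $R$ or $R\cap C$ is non-constant; symmetrically for column parts; the stretch value of a partition is the maximum over its parts. $\mathrm{stw}(M)$ is the minimum over symmetric partition sequences of the maximum stretch value of a partition in the sequence. *)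

theory Defs
  imports "HOL-Library.Disjoint_Sets" "Jordan_Normal_Form.Matrix"
begin

section \<open>Symmetric partition sequences and stretch-width\<close>

text \<open>
  Rows and columns of an n by n matrix are represented by their indices \<open>0, \<dots>, n - 1\<close>.
  A row part and a column part are therefore both sets of indices, and the symmetric of a part
  is the same set of indices, read on the other side.
\<close>

type_synonym partition_pair = "nat set set \<times> nat set set"

definition same_part :: "nat set set \<Rightarrow> nat \<Rightarrow> nat \<Rightarrow> bool" where
  "same_part \<P> i j \<longleftrightarrow> (\<exists>X\<in>\<P>. i \<in> X \<and> j \<in> X)"

fun symmetric_partition :: "nat \<Rightarrow> partition_pair \<Rightarrow> bool" where
  "symmetric_partition n (\<R>, \<C>) \<longleftrightarrow>
     partition_on {..<n} \<R> \<and> partition_on {..<n} \<C> \<and>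
     (\<forall>i<n. \<forall>j<n. same_part \<R> i j \<longleftrightarrow> same_part \<C> i j)"

definition singletons :: "nat \<Rightarrow> nat set set" where
  "singletons n = (\<lambda>i. {i}) ` {..<n}"

definition merge_parts :: "nat set \<Rightarrow> nat set \<Rightarrow> nat set set \<Rightarrow> nat set set" where
  "merge_parts A B \<P> = insert (A \<union> B) (\<P> - {A, B})"

text \<open>Merging the row parts A and B, together with their symmetric column parts.\<close>

fun merge_step :: "partition_pair \<Rightarrow> partition_pair \<Rightarrow> bool" where
  "merge_step (\<R>, \<C>) (\<R>', \<C>') \<longleftrightarrow>
     (\<exists>A B. A \<in> \<R> \<and> B \<in> \<R> \<and> A \<noteq> B \<and> A \<in> \<C> \<and> B \<in> \<C> \<and>
        \<R>' = merge_parts A B \<R> \<and> \<C>' = merge_parts A B \<C>)"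

text \<open>
  The list \<open>Ps\<close> starts with the finest partition: \<open>Ps ! t\<close> has \<open>n - t\<close> row parts.
\<close>

definition symmetric_partition_sequence :: "nat \<Rightarrow> partition_pair list \<Rightarrow> bool" where
  "symmetric_partition_sequence n Ps \<longleftrightarrow>
     length Ps = n \<and> Ps \<noteq> [] \<and>
     (\<forall>P\<in>set Ps. symmetric_partition n P) \<and>
     hd Ps = (singletons n, singletons n) \<and>
     card (fst (last Ps)) = 1 \<and> card (snd (last Ps)) = 1 \<and>
     successively merge_step Ps"

text \<open>Here \<open>R\<close> is a set of row indices and \<open>C\<close> a set of column indices.\<close>

definition nonconstant_zone :: "int mat \<Rightarrow> nat set \<Rightarrow> nat set \<Rightarrow> bool" where
  "nonconstant_zone M R C \<longleftrightarrow>
     (\<exists>i\<in>R. \<exists>j\<in>C. \<exists>i'\<in>R. \<exists>j'\<in>C. M $$ (i, j) \<noteq> M $$ (i', j'))"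

text \<open>\<open>span_of\<close> is only meant for finite nonempty sets.\<close>

definition span_of :: "nat set \<Rightarrow> nat set" where
  "span_of X = {Min X..Max X}"

definition conflict :: "nat set \<Rightarrow> nat set \<Rightarrow> bool" where
  "conflict X Y \<longleftrightarrow> span_of X \<inter> span_of Y \<noteq> {}"

definition row_stretch :: "int mat \<Rightarrow> nat set set \<Rightarrow> nat set \<Rightarrow> nat" where
  "row_stretch M \<C> R =
     card {C' \<in> \<C>. conflict C' (\<Union> {C \<in> \<C>. C = R \<or> nonconstant_zone M R C})}"

definition col_stretch :: "int mat \<Rightarrow> nat set set \<Rightarrow> nat set \<Rightarrow> nat" where
  "col_stretch M \<R> C =
     card {R' \<in> \<R>. conflict R' (\<Union> {R \<in> \<R>. R = C \<or> nonconstant_zone M R C})}"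

fun stretch_value :: "int mat \<Rightarrow> partition_pair \<Rightarrow> nat" where
  "stretch_value M (\<R>, \<C>) = Max (row_stretch M \<C> ` \<R> \<union> col_stretch M \<R> ` \<C>)"

definition stw :: "int mat \<Rightarrow> nat" where
  "stw M = Inf {Max (stretch_value M ` set Ps) | Ps. symmetric_partition_sequence (dim_row M) Ps}"


section \<open>The machine model\<close>

text \<open>
  Random access machine programs in structured form: finitely many integer variables, finitely many
  integer-indexed integer arrays, and unit cost for each elementary operation. The only arithmetic
  operations are addition and subtraction. Hence, for a fixed program, bit lengths are linear in
  the input bit length plus the number of steps, so that, up to polynomial factors, unit cost agrees
  with logarithmic cost and with Turing machine time.
\<close>

type_synonym name = string

type_synonym state = "(name \<Rightarrow> int) \<times> (name \<Rightarrow> int \<Rightarrow> int)"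

datatype aexp =
    Lit int
  | Var name
  | Read name aexp
  | Add aexp aexp
  | Sub aexp aexp

datatype bexp =
    Leq aexp aexp
  | Neg bexp
  | Conj bexp bexp

datatype com =
    Skip
  | Assign name aexp
  | Write name aexp aexp  \<comment> \<open>array, index, new value\<close>
  | Seq com com
  | Cond bexp com com
  | While bexp com

fun aval :: "aexp \<Rightarrow> state \<Rightarrow> int" where
  "aval (Lit c) s = c"
| "aval (Var x) s = fst s x"
| "aval (Read a e) s = snd s a (aval e s)"
| "aval (Add e f) s = aval e s + aval f s"
| "aval (Sub e f) s = aval e s - aval f s"

fun acost :: "aexp \<Rightarrow> nat" where
  "acost (Lit c) = 1"
| "acost (Var x) = 1"
| "acost (Read a e) = 1 + acost e"
| "acost (Add e f) = 1 + acost e + acost f"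
| "acost (Sub e f) = 1 + acost e + acost f"

fun bval :: "bexp \<Rightarrow> state \<Rightarrow> bool" where
  "bval (Leq e f) s \<longleftrightarrow> aval e s \<le> aval f s"
| "bval (Neg b) s \<longleftrightarrow> \<not> bval b s"
| "bval (Conj b c) s \<longleftrightarrow> bval b s \<and> bval c s"

fun bcost :: "bexp \<Rightarrow> nat" where
  "bcost (Leq e f) = 1 + acost e + acost f"
| "bcost (Neg b) = 1 + bcost b"
| "bcost (Conj b c) = 1 + bcost b + bcost c"

text \<open>\<open>exec p s t s'\<close>: started in \<open>s\<close>, the program \<open>p\<close> halts in \<open>s'\<close> after time \<open>t\<close>.\<close>

inductive exec :: "com \<Rightarrow> state \<Rightarrow> nat \<Rightarrow> state \<Rightarrow> bool" where
  Skip: "exec Skip s 1 s"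
| Assign: "exec (Assign x e) s (1 + acost e) ((fst s)(x := aval e s), snd s)"
| Write: "exec (Write a e f) s (1 + acost e + acost f)
            (fst s, (snd s)(a := (snd s a)(aval e s := aval f s)))"
| Seq: "exec p s t s' \<Longrightarrow> exec q s' t' s'' \<Longrightarrow> exec (Seq p q) s (t + t') s''"
| CondTrue: "bval b s \<Longrightarrow> exec p s t s' \<Longrightarrow> exec (Cond b p q) s (1 + bcost b + t) s'"
| CondFalse: "\<not> bval b s \<Longrightarrow> exec q s t s' \<Longrightarrow> exec (Cond b p q) s (1 + bcost b + t) s'"
| WhileFalse: "\<not> bval b s \<Longrightarrow> exec (While b p) s (1 + bcost b) s"
| WhileTrue: "bval b s \<Longrightarrow> exec p s t s' \<Longrightarrow> exec (While b p) s' t' s'' \<Longrightarrow>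
    exec (While b p) s (1 + bcost b + t + t') s''"

lemma exec_deterministic:
  "exec p s t s' \<Longrightarrow> exec p s u v \<Longrightarrow> u = t \<and> v = s'"
proof (induction arbitrary: u v rule: exec.induct)
  case (Seq p s t s' q t' s'')
  from Seq.prems obtain t1 s1 t2 where "u = t1 + t2" "exec p s t1 s1" "exec q s1 t2 v"
    by (cases rule: exec.cases) auto
  with Seq.IH show ?case by metis
next
  case (WhileTrue b s p t s' t' s'')
  from WhileTrue.prems WhileTrue.hyps(1) obtain t1 s1 t2 where
    "u = 1 + bcost b + t1 + t2" "exec p s t1 s1" "exec (While b p) s1 t2 v"
    by (cases rule: exec.cases) auto
  with WhileTrue.IH show ?case by metis
next
  case (WhileFalse b s p)
  from WhileFalse.prems WhileFalse.hyps show ?case by (cases rule: exec.cases) auto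
next
  case (CondTrue b s p t s' q)
  from CondTrue.prems CondTrue.hyps(1) obtain t1 where "u = 1 + bcost b + t1" "exec p s t1 v"
    by (cases rule: exec.cases) auto
  with CondTrue.IH show ?case by metis
next
  case (CondFalse b s q t s' p)
  from CondFalse.prems CondFalse.hyps(1) obtain t1 where "u = 1 + bcost b + t1" "exec q s t1 v"
    by (cases rule: exec.cases) auto
  with CondFalse.IH show ?case by metis
qed (erule exec.cases; simp)+


section \<open>Input and output conventions\<close>

text \<open>
  The input consists of the variables \<open>n\<close> and \<open>k\<close> and of the array \<open>M\<close>, which holds the matrix
  in row-major order. All other memory is zero.
\<close>

definition input_state :: "nat \<Rightarrow> int \<Rightarrow> int mat \<Rightarrow> state" where
  "input_state n k M =
     ((\<lambda>_. 0)(''n'' := int n, ''k'' := k),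
      (\<lambda>_ _. 0)(''M'' := (\<lambda>z. if 0 \<le> z \<and> z < int (n * n)
                               then M $$ (nat z div n, nat z mod n) else 0)))"

text \<open>
  The output variable \<open>answer\<close> is 1 if a partition sequence is output, and 0 if the algorithm
  reports that the stretch-width exceeds k. The partition sequence is output in the arrays \<open>rows\<close>
  and \<open>cols\<close>: position \<open>t * n + i\<close> holds the label of the part of the i-th row (column) in
  the t-th partition, two rows (columns) being in the same part if they have the same label.
\<close>

definition partition_of_labels :: "nat \<Rightarrow> (nat \<Rightarrow> int) \<Rightarrow> nat set set" where
  "partition_of_labels n f = (\<lambda>i. {j. j < n \<and> f j = f i}) ` {..<n}"

definition output_sequence :: "nat \<Rightarrow> state \<Rightarrow> partition_pair list" where
  "output_sequence n s =
     map (\<lambda>t. (partition_of_labels n (\<lambda>i. snd s ''rows'' (int (t * n + i))),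
               partition_of_labels n (\<lambda>i. snd s ''cols'' (int (t * n + i))))) [0..<n]"

definition outputs_sequence :: "nat \<Rightarrow> state \<Rightarrow> partition_pair list \<Rightarrow> bool" where
  "outputs_sequence n s Ps \<longleftrightarrow> fst s ''answer'' = 1 \<and> Ps = output_sequence n s"

definition reports_large :: "state \<Rightarrow> bool" where
  "reports_large s \<longleftrightarrow> fst s ''answer'' = 0"

end

theory Submission
  imports Defs
begin

text \<open>
  Call a partition of the indices into consecutive intervals a division, and call two indices of the
  same interval twins if their rows agree outside the window made of this interval and the two
  intervals on either side. By symmetry, a zone of two twin classes whose intervals are more than two
  apart is constant, so if every interval contains at most H classes then the stretch value of the
  partition into twin classes is at most 5H. Merging two consecutive intervals only coarsens the
  twin relation. The algorithm greedily merges consecutive intervals as long as the new interval has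
  at most k + 2 twin classes, and after each such step merges the parts that have become twins one
  pair at a time; meanwhile an interval contains at most 2(k + 2) parts.

  If stw(M) is at most k, this never gets stuck. Take a good partition sequence and its first
  partition in which the span of some part together with its non-constant zones contains two
  consecutive intervals. At most k parts conflict with that span, so at most k + 2 parts of the
  previous partition meet the two intervals. In the previous partition every such span contains no two
  consecutive intervals, hence lies in the window, so indices in the same part are twins.
  This gives a bound that is even linear in k.
\<close>

text \<open>The window has radius two for the following reason. Once two consecutive intervals have
  become one, an index outside the window of the new interval is separated from it by two whole
  consecutive intervals of the old division, and that is exactly what the spans of the earlier
  partition cannot contain. A good sequence is unknown to the algorithm and its parts ignore the
  intervals, so it is never followed. Twin classes stand in for the unknown parts because they
  depend on the matrix and the division alone and can be computed in polynomial time. The five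
  intervals of a window, with up to 2(k + 2) parts each, give the bound 10(k + 2), which is at most
  30 k^3 for positive k. A nonpositive k is always exceeded, since every part conflicts with its own
  symmetric.\<close>

section \<open>Programs with for loops\<close>

text \<open>
  Every loop runs exactly n times, so a polynomial time bound and termination come for free and a
  program denotes a total function on states.
\<close>

datatype loop =
    LSkip
  | LAssign name aexp
  | LWrite name aexp aexp
  | LSeq loop loop
  | LCond bexp loop loop
  | For name loop

primrec compile :: "loop \<Rightarrow> com" where
  "compile LSkip = Skip"
| "compile (LAssign x e) = Assign x e"
| "compile (LWrite a e f) = Write a e f"
| "compile (LSeq p q) = Seq (compile p) (compile q)"
| "compile (LCond b p q) = Cond b (compile p) (compile q)"
| "compile (For x p) =
     Seq (Assign x (Lit 0))
       (While (Neg (Leq (Var ''n'') (Var x)))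
         (Seq (compile p) (Assign x (Add (Var x) (Lit 1)))))"

definition set_var :: "name \<Rightarrow> int \<Rightarrow> state \<Rightarrow> state" where
  "set_var x v s = ((fst s)(x := v), snd s)"

definition set_arr :: "name \<Rightarrow> int \<Rightarrow> int \<Rightarrow> state \<Rightarrow> state" where
  "set_arr a z v s = (fst s, (snd s)(a := (snd s a)(z := v)))"

lemma fst_set_var [simp]: "fst (set_var x v s) y = (if y = x then v else fst s y)"
  and snd_set_var [simp]: "snd (set_var x v s) = snd s"
  and fst_set_arr [simp]: "fst (set_arr a z v s) = fst s"
  and snd_set_arr [simp]:
    "snd (set_arr a z v s) b = (if b = a then (snd s a)(z := v) else snd s b)"
  by (auto simp: set_var_def set_arr_def)

text \<open>The counter values come from a list fixed at entry, whereas the compiled loop tests and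
  increments a variable. The outer \<open>set_var\<close> reproduces the value of that variable when
  the test fails, so that the two final states agree exactly.\<close>

primrec run :: "loop \<Rightarrow> state \<Rightarrow> state" where
  "run LSkip = (\<lambda>s. s)"
| "run (LAssign x e) = (\<lambda>s. set_var x (aval e s) s)"
| "run (LWrite a e f) = (\<lambda>s. set_arr a (aval e s) (aval f s) s)"
| "run (LSeq p q) = (\<lambda>s. run q (run p s))"
| "run (LCond b p q) = (\<lambda>s. if bval b s then run p s else run q s)"
| "run (For x p) = (\<lambda>s. set_var x (int (nat (fst s ''n'')))
     (fold (\<lambda>i s. run p (set_var x (int i) s)) [0..<nat (fst s ''n'')] s))"

primrec vars :: "loop \<Rightarrow> name set" where
  "vars LSkip = {}"
| "vars (LAssign x e) = {x}"
| "vars (LWrite a e f) = {}"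
| "vars (LSeq p q) = vars p \<union> vars q"
| "vars (LCond b p q) = vars p \<union> vars q"
| "vars (For x p) = insert x (vars p)"

primrec arrays :: "loop \<Rightarrow> name set" where
  "arrays LSkip = {}"
| "arrays (LAssign x e) = {}"
| "arrays (LWrite a e f) = {a}"
| "arrays (LSeq p q) = arrays p \<union> arrays q"
| "arrays (LCond b p q) = arrays p \<union> arrays q"
| "arrays (For x p) = arrays p"

text \<open>These conditions fix the number of rounds of a loop: the body changes neither the bound
  \<open>n\<close>, which is read again at each test, nor the counter.\<close>

primrec well_formed :: "loop \<Rightarrow> bool" where
  "well_formed LSkip = True"
| "well_formed (LAssign x e) \<longleftrightarrow> x \<noteq> ''n''"
| "well_formed (LWrite a e f) = True"
| "well_formed (LSeq p q) \<longleftrightarrow> well_formed p \<and> well_formed q"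
| "well_formed (LCond b p q) \<longleftrightarrow> well_formed p \<and> well_formed q"
| "well_formed (For x p) \<longleftrightarrow> well_formed p \<and> x \<noteq> ''n'' \<and> x \<notin> vars p"

lemma n_notin_vars [simp]: "well_formed p \<Longrightarrow> ''n'' \<notin> vars p"
  by (induction p) auto

text \<open>An upper bound that charges both branches of a conditional. In a loop, 2 pays for the
  initial assignment, 5 for each evaluation of the test including the last one, and 4 for the
  increment; hence 7 and 9.\<close>

primrec cost :: "loop \<Rightarrow> nat \<Rightarrow> nat" where
  "cost LSkip n = 1"
| "cost (LAssign x e) n = 1 + acost e"
| "cost (LWrite a e f) n = 1 + acost e + acost f"
| "cost (LSeq p q) n = cost p n + cost q n"
| "cost (LCond b p q) n = 1 + bcost b + cost p n + cost q n"
| "cost (For x p) n = 7 + n * (9 + cost p n)"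

lemma fst_run [simp]: "x \<notin> vars p \<Longrightarrow> fst (run p s) x = fst s x"
proof (induction p arbitrary: s)
  case (For y p)
  have "fst (fold (\<lambda>i s. run p (set_var y (int i) s)) is s) x = fst s x" for "is"
    using For by (induction "is" arbitrary: s) auto
  with For.prems show ?case by simp
qed auto

lemma snd_run [simp]: "a \<notin> arrays p \<Longrightarrow> snd (run p s) a = snd s a"
proof (induction p arbitrary: s)
  case (For y p)
  have "snd (fold (\<lambda>i s. run p (set_var y (int i) s)) is s) a = snd s a" for "is"
    using For by (induction "is" arbitrary: s) auto
  then show ?case by simp
qed auto

lemma exec_compile:
  assumes "well_formed p" and "fst s ''n'' = int n"
  shows "\<exists>t\<le>cost p n. exec (compile p) s t (run p s)"
  using assms
proof (induction p arbitrary: s)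
  case LSkip
  show ?case using exec.Skip[of s] by auto
next
  case (LAssign x e)
  show ?case using exec.Assign[of x e s] by (auto simp: set_var_def)
next
  case (LWrite a e f)
  show ?case using exec.Write[of a e f s] by (auto simp: set_arr_def)
next
  case (LSeq p q)
  then have "fst (run p s) ''n'' = int n" by simp
  with LSeq obtain t t' where "t \<le> cost p n" "exec (compile p) s t (run p s)"
    "t' \<le> cost q n" "exec (compile q) (run p s) t' (run q (run p s))"
    by (metis well_formed.simps(4))
  then show ?case
    by (intro exI[of _ "t + t'"]) (auto intro: exec.Seq)
next
  case (LCond b p q)
  then obtain t t' where t: "t \<le> cost p n" "exec (compile p) s t (run p s)"
    "t' \<le> cost q n" "exec (compile q) s t' (run q s)"
    by (metis well_formed.simps(5))
  show ?case
  proof (cases "bval b s")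
    case True
    with exec.CondTrue[OF this t(2)] t(1) show ?thesis
      by (intro exI[of _ "1 + bcost b + t"]) auto
  next
    case False
    with exec.CondFalse[OF this t(4)] t(3) show ?thesis
      by (intro exI[of _ "1 + bcost b + t'"]) auto
  qed
next
  case (For x p)
  define h where "h i = fold (\<lambda>i s. run p (set_var x (int i) s)) [0..<i] s" for i
  have h_Suc: "h (Suc i) = run p (set_var x (int i) (h i))" for i
    by (simp add: h_def)
  have h_n: "fst (h i) ''n'' = int n" for i
    using For.prems by (induction i) (auto simp: h_Suc, simp add: h_def)
  let ?b = "Neg (Leq (Var ''n'') (Var x))"
  let ?w = "While ?b (Seq (compile p) (Assign x (Add (Var x) (Lit 1))))"
  \<comment> \<open>The derivation of a while loop is built backwards from its last test, hence the
    induction from \<open>n\<close> down to \<open>i\<close>.\<close>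
  have loop: "\<exists>t\<le>5 + (n - i) * (9 + cost p n). exec ?w (set_var x (int i) (h i)) t (set_var x (int n) (h n))"
    if "i \<le> n" for i
    using that
  proof (induction i rule: inc_induct)
    case base
    have "\<not> bval ?b (set_var x (int n) (h n))"
      using h_n For.prems by simp
    from exec.WhileFalse[OF this] show ?case by (intro exI[of _ "1 + bcost ?b"]) auto
  next
    case (step i)
    let ?s = "set_var x (int i) (h i)"
    have b: "bval ?b ?s" using step.hyps h_n For.prems by auto
    obtain t where t: "t \<le> cost p n" "exec (compile p) ?s t (h (Suc i))"
      using For.IH[of ?s] For.prems h_n by (auto simp: h_Suc)
    have "fst (h (Suc i)) x = int i"
      using For.prems by (simp add: h_Suc)
    then have "set_var x (int (Suc i)) (h (Suc i)) =
        ((fst (h (Suc i)))(x := aval (Add (Var x) (Lit 1)) (h (Suc i))), snd (h (Suc i)))"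
      by (simp add: set_var_def add.commute)
    with exec.Assign[of x "Add (Var x) (Lit 1)" "h (Suc i)"]
    have "exec (Assign x (Add (Var x) (Lit 1))) (h (Suc i)) 4 (set_var x (int (Suc i)) (h (Suc i)))"
      by (simp add: eval_nat_numeral)
    from exec.Seq[OF t(2) this] have body: "exec (Seq (compile p) (Assign x (Add (Var x) (Lit 1)))) ?s (t + 4)
       (set_var x (int (Suc i)) (h (Suc i)))" .
    from step.IH obtain t' where t': "t' \<le> 5 + (n - Suc i) * (9 + cost p n)"
      "exec ?w (set_var x (int (Suc i)) (h (Suc i))) t' (set_var x (int n) (h n))"
      by blast
    have "n - i = Suc (n - Suc i)" using step.hyps by simp
    then show ?case
      using exec.WhileTrue[OF b body t'(2)] t(1) t'(1)
      by (intro exI[of _ "1 + bcost ?b + (t + 4) + t'"]) auto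
  qed
  have init: "exec (Assign x (Lit 0)) s 2 (set_var x (int 0) (h 0))"
    using exec.Assign[of x "Lit 0" s] by (simp add: set_var_def h_def eval_nat_numeral)
  obtain t where t: "t \<le> 5 + n * (9 + cost p n)"
    "exec ?w (set_var x (int 0) (h 0)) t (set_var x (int n) (h n))"
    using loop[of 0] by auto
  have "run (For x p) s = set_var x (int n) (h n)"
    using For.prems by (simp add: h_def)
  then have "exec (compile (For x p)) s (2 + t) (run (For x p) s)"
    using exec.Seq[OF init t(2)] by (simp only: compile.simps)
  then show ?case using t(1) by (intro exI[of _ "2 + t"]) simp
qed

lemma cost_polynomial: "\<exists>a d. \<forall>n\<ge>1. cost p n \<le> a * n ^ d"
proof -
  have const: "c \<le> c * n ^ d" if "n \<ge> 1" for c n d :: nat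
    using that by simp
  have add: "\<exists>a d. \<forall>n\<ge>1. f n + g n \<le> a * n ^ d"
    if "\<exists>a d. \<forall>n\<ge>1. f n \<le> a * n ^ d" "\<exists>a d. \<forall>n\<ge>1. g n \<le> a * n ^ d" for f g :: "nat \<Rightarrow> nat"
  proof -
    from that obtain a d a' d' where *: "\<forall>n\<ge>1. f n \<le> a * n ^ d" "\<forall>n\<ge>1. g n \<le> a' * n ^ d'"
      by blast
    \<comment> \<open>Adding the exponents is a crude substitute for their maximum; it works because
      n is at least 1.\<close>
    have "f n + g n \<le> (a + a') * n ^ (d + d')" if "n \<ge> 1" for n
    proof -
      have "f n \<le> a * n ^ (d + d')" "g n \<le> a' * n ^ (d + d')"
        using * that by (meson le_trans mult_le_mono2 power_increasing le_add1 le_add2)+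
      then show ?thesis by (simp add: distrib_right)
    qed
    then show ?thesis by blast
  qed
  have cst: "\<exists>a d. \<forall>n\<ge>(1::nat). c \<le> a * n ^ d" for c :: nat
    using const by blast
  show ?thesis
  proof (induction p)
    case (LSeq p q)
    then show ?case using add by simp
  next
    case (LCond b p q)
    have "\<exists>a d. \<forall>n\<ge>1. ((1 + bcost b) + cost p n) + cost q n \<le> a * n ^ d"
      by (intro add cst LCond)
    then show ?case by simp
  next
    case (For x p)
    have "\<exists>a d. \<forall>n\<ge>1. n * (9 + cost p n) \<le> a * n ^ d"
    proof -
      obtain a d where "\<forall>n\<ge>1. 9 + cost p n \<le> a * n ^ d" using add[OF cst For] by blast
      then have "\<forall>n\<ge>1. n * (9 + cost p n) \<le> a * n ^ Suc d"
        by (metis mult.left_commute mult_le_mono2 power_Suc)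
      then show ?thesis by blast
    qed
    from add[OF cst this] show ?case by simp
  qed (use cst in simp_all)
qed

text \<open>The invariant is stated before the counter is set for round i, so it need not mention
  the counter, whose exit value appears only in the final \<open>set_var\<close>.\<close>

lemma run_For_invariant:
  assumes "fst s ''n'' = int n" and "I 0 s"
    and "\<And>i s'. i < n \<Longrightarrow> I i s' \<Longrightarrow> I (Suc i) (run p (set_var x (int i) s'))"
  obtains s' where "I n s'" "run (For x p) s = set_var x (int n) s'"
proof -
  let ?h = "\<lambda>i. fold (\<lambda>i s. run p (set_var x (int i) s)) [0..<i] s"
  have "I i (?h i)" if "i \<le> n" for i
    using that by (induction i) (use assms in auto)
  then show ?thesis using that[of "?h n"] assms(1) by simp
qed

declare run.simps(6) [simp del]

text \<open>Loops have no early exit, so bounded quantifiers are evaluated by counting: a universal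
  statement holds iff the tally of its violations is zero. The same construct counts twin
  classes.\<close>

definition tally :: "name \<Rightarrow> name \<Rightarrow> loop \<Rightarrow> name \<Rightarrow> loop" where
  "tally r x p f =
     LSeq (LAssign r (Lit 0)) (For x (LSeq p (LAssign r (Add (Var r) (Var f)))))"

lemma vars_tally [simp]: "vars (tally r x p f) = {r, x} \<union> vars p"
  and arrays_tally [simp]: "arrays (tally r x p f) = arrays p"
  and well_formed_tally [simp]: "well_formed (tally r x p f) \<longleftrightarrow>
    well_formed p \<and> x \<noteq> ''n'' \<and> x \<noteq> r \<and> x \<notin> vars p \<and> r \<noteq> ''n''"
  by (auto simp: tally_def)

text \<open>The body changes no array and only its scratch variables, so each round sees the
  original data and the flag depends on i alone. The frame premises in \<open>val\<close> expose
  this and let tallies nest.\<close>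

lemma run_tally:
  assumes "well_formed (tally r x p f)" and "arrays p = {}" and "r \<notin> vars p" and "f \<noteq> r"
    and "fst s ''n'' = int n"
    and val: "\<And>i s'. i < n \<Longrightarrow> fst s' x = int i \<Longrightarrow> snd s' = snd s \<Longrightarrow>
      (\<And>y. y \<notin> insert r (insert x (vars p)) \<Longrightarrow> fst s' y = fst s y) \<Longrightarrow>
      fst (run p s') f = g i"
  shows "fst (run (tally r x p f) s) r = (\<Sum>i<n. g i)"
proof -
  let ?I = "\<lambda>i s'. snd s' = snd s \<and> (\<forall>y. y \<notin> insert r (insert x (vars p)) \<longrightarrow> fst s' y = fst s y) \<and>
    fst s' r = (\<Sum>j<i. g j)"
  have snd: "snd (run p s') = snd s'" for s'
    using assms(2) by (intro ext) simp
  obtain s' where s': "?I n s'" "run (For x (LSeq p (LAssign r (Add (Var r) (Var f))))) (set_var r 0 s)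
      = set_var x (int n) s'"
  proof (rule run_For_invariant[where I = ?I and n = n and s = "set_var r 0 s" and x = x
        and p = "LSeq p (LAssign r (Add (Var r) (Var f)))"])
    fix i s' assume i: "i < n" "?I i s'"
    have "fst (run p (set_var x (int i) s')) f = g i"
      by (rule val) (use i in auto)
    then show "?I (Suc i) (run (LSeq p (LAssign r (Add (Var r) (Var f)))) (set_var x (int i) s'))"
      using i assms by (auto simp: snd)
  qed (use assms(1,5) in auto)
  have "fst (run (tally r x p f) s) r = fst (set_var x (int n) s') r"
    using s'(2) by (simp add: tally_def)
  then show ?thesis using s'(1) assms(1) by auto
qed

definition indicator :: "name \<Rightarrow> bexp \<Rightarrow> loop" where
  "indicator f b = LCond b (LAssign f (Lit 1)) (LAssign f (Lit 0))"

lemma vars_indicator [simp]: "vars (indicator f b) = {f}"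
  and arrays_indicator [simp]: "arrays (indicator f b) = {}"
  and well_formed_indicator [simp]: "well_formed (indicator f b) \<longleftrightarrow> f \<noteq> ''n''"
  and run_indicator [simp]: "run (indicator f b) s = set_var f (of_bool (bval b s)) s"
  by (auto simp: indicator_def)

section \<open>Divisions and twins\<close>

definition near :: "(nat \<Rightarrow> int) \<Rightarrow> nat \<Rightarrow> nat \<Rightarrow> bool" where
  "near p i c \<longleftrightarrow> p c \<le> p i + 2 \<and> p i \<le> p c + 2"

definition twins :: "int mat \<Rightarrow> nat \<Rightarrow> (nat \<Rightarrow> int) \<Rightarrow> nat \<Rightarrow> nat \<Rightarrow> bool" where
  "twins M n p i j \<longleftrightarrow> p i = p j \<and> (\<forall>c<n. near p i c \<or> M $$ (i, c) = M $$ (j, c))"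

definition fiber :: "nat \<Rightarrow> (nat \<Rightarrow> int) \<Rightarrow> int \<Rightarrow> nat set" where
  "fiber n p a = {i. i < n \<and> p i = a}"

text \<open>Leaders represent the twin classes of an interval.\<close>

definition leaders :: "int mat \<Rightarrow> nat \<Rightarrow> (nat \<Rightarrow> int) \<Rightarrow> int \<Rightarrow> nat set" where
  "leaders M n p a = {i \<in> fiber n p a. \<forall>j<i. \<not> twins M n p j i}"

definition merge_fibers :: "int \<Rightarrow> (nat \<Rightarrow> int) \<Rightarrow> nat \<Rightarrow> int" where
  "merge_fibers a p i = (if p i \<le> a then p i else p i - 1)"

text \<open>Starting at 0 and rising by at most 1, \<open>p\<close> numbers consecutive non-empty
  intervals, the last one being \<open>p (n - 1)\<close>. The value 0 from \<open>n\<close> on makes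
  \<open>merge_fibers a p = p\<close> an equality of functions when there is nothing to
  merge.\<close>

definition division :: "nat \<Rightarrow> (nat \<Rightarrow> int) \<Rightarrow> bool" where
  "division n p \<longleftrightarrow> p 0 = 0 \<and> (\<forall>i j. i \<le> j \<longrightarrow> j < n \<longrightarrow> p i \<le> p j) \<and>
     (\<forall>i. Suc i < n \<longrightarrow> p (Suc i) \<le> p i + 1) \<and> (\<forall>i\<ge>n. p i = 0)"

lemma twins_refl [simp]: "twins M n p i i"
  by (simp add: twins_def)

lemma twins_sym: "twins M n p i j \<Longrightarrow> twins M n p j i"
  by (auto simp: twins_def near_def)

lemma twins_trans: "twins M n p i j \<Longrightarrow> twins M n p j l \<Longrightarrow> twins M n p i l"
  unfolding twins_def near_def by metis

text \<open>The renumbering is monotone and never widens the gap between two intervals, so windows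
  can only gain indices.\<close>

lemma near_merge_fibers: "near p i c \<Longrightarrow> near (merge_fibers a p) i c"
  by (auto simp: near_def merge_fibers_def)

lemma twins_merge_fibers: "twins M n p i j \<Longrightarrow> twins M n (merge_fibers a p) i j"
  unfolding twins_def using near_merge_fibers by (auto simp: merge_fibers_def)

lemma division_merge_fibers:
  assumes "division n p" and "0 \<le> a"
  shows "division n (merge_fibers a p)"
proof -
  have p: "p 0 = 0" "\<And>i j. i \<le> j \<Longrightarrow> j < n \<Longrightarrow> p i \<le> p j" "\<And>i. Suc i < n \<Longrightarrow> p (Suc i) \<le> p i + 1"
    "\<And>i. n \<le> i \<Longrightarrow> p i = 0"
    using assms(1) by (auto simp: division_def)
  have "merge_fibers a p i \<le> merge_fibers a p j" if "i \<le> j" "j < n" for i j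
    using p(2)[OF that] by (simp add: merge_fibers_def)
  moreover have "merge_fibers a p (Suc i) \<le> merge_fibers a p i + 1" if "Suc i < n" for i
    using p(3)[OF that] p(2)[of i "Suc i"] that by (auto simp: merge_fibers_def)
  ultimately show ?thesis using p(1,4) assms(2) by (auto simp: division_def merge_fibers_def)
qed

text \<open>This lets the program try every \<open>a\<close> below \<open>n\<close> without testing
  whether a next interval exists.\<close>

lemma merge_fibers_trivial:
  assumes "division n p" and "p (n - 1) \<le> a" and "0 \<le> a"
  shows "merge_fibers a p = p"
proof
  fix i
  have "p i \<le> a"
  proof (cases "i < n")
    case True
    then have "p i \<le> p (n - 1)" using assms(1) by (simp add: division_def)
    with assms(2) show ?thesis by simp
  next
    case False
    then show ?thesis using assms(1,3) by (simp add: division_def)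
  qed
  then show "merge_fibers a p i = p i" by (simp add: merge_fibers_def)
qed

lemma finite_fiber [simp]: "finite (fiber n p a)"
  by (simp add: fiber_def)

lemma division_bounds:
  assumes "division n p" and "i < n"
  shows "0 \<le> p i" and "p i \<le> p (n - 1)"
proof -
  have "p 0 \<le> p i" using assms unfolding division_def by blast
  then show "0 \<le> p i" using assms by (simp add: division_def)
  show "p i \<le> p (n - 1)" using assms by (simp add: division_def)
qed

text \<open>Discrete intermediate value argument: \<open>p\<close> climbs from 0 in steps of at most
  1.\<close>

lemma fiber_nonempty:
  assumes "division n p" and "0 \<le> a" and "a \<le> p (n - 1)" and "1 \<le> n"
  shows "fiber n p a \<noteq> {}"
proof -
  have "\<exists>i<n. p i = a" if "a \<le> p m" "m < n" for m
    using that
  proof (induction m)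
    case 0
    then show ?case using assms(1,2) by (auto simp: division_def)
  next
    case (Suc m)
    have "p (Suc m) \<le> p m + 1" using assms(1) Suc.prems by (simp add: division_def)
    then show ?case using Suc by (cases "a \<le> p m") auto
  qed
  from this[of "n - 1"] assms show ?thesis by (auto simp: fiber_def)
qed

section \<open>Stretch values of partitions into twins\<close>

lemma nonconstant_zone_swap:
  assumes "nonconstant_zone M R C" and "\<And>i j. i \<in> R \<Longrightarrow> j \<in> C \<Longrightarrow> M $$ (i, j) = M $$ (j, i)"
  shows "nonconstant_zone M C R"
proof -
  obtain i j i' j' where "i \<in> R" "j \<in> C" "i' \<in> R" "j' \<in> C" "M $$ (i, j) \<noteq> M $$ (i', j')"
    using assms(1) by (auto simp: nonconstant_zone_def)
  moreover from this have "M $$ (j, i) \<noteq> M $$ (j', i')" using assms(2) by metis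
  ultimately show ?thesis unfolding nonconstant_zone_def by blast
qed

text \<open>By symmetry the zone of \<open>Y\<close> and \<open>X\<close> is the transpose of that
  of \<open>X\<close> and \<open>Y\<close>, and transposing preserves being constant; so upper
  bounds are needed for rows only.\<close>

lemma col_stretch_eq_row_stretch:
  assumes sym: "\<forall>i<n. \<forall>j<n. M $$ (i, j) = M $$ (j, i)" and "partition_on {..<n} Q"
    and "X \<in> Q"
  shows "col_stretch M Q X = row_stretch M Q X"
proof -
  have sub: "Y \<subseteq> {..<n}" if "Y \<in> Q" for Y
    using assms(2) that by (auto simp: partition_on_def)
  have "nonconstant_zone M Y X = nonconstant_zone M X Y" if "Y \<in> Q" for Y
  proof -
    have "M $$ (i, j) = M $$ (j, i)" if "i \<in> X" "j \<in> Y" for i j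
      using sym sub[OF assms(3)] sub[OF \<open>Y \<in> Q\<close>] that by blast
    then show ?thesis
      using nonconstant_zone_swap[of M X Y] nonconstant_zone_swap[of M Y X] by metis
  qed
  then have "{R \<in> Q. R = X \<or> nonconstant_zone M R X} = {C \<in> Q. C = X \<or> nonconstant_zone M X C}"
    by blast
  then show ?thesis by (simp add: row_stretch_def col_stretch_def)
qed

lemma conflict_subset:
  assumes "Y \<noteq> {}" and "Y \<subseteq> U" and "finite U"
  shows "conflict Y U"
proof -
  obtain z where "z \<in> Y" using assms(1) by blast
  moreover have "finite Y" using assms(2,3) by (rule finite_subset)
  ultimately have "z \<in> span_of Y \<inter> span_of U" using assms by (auto simp: span_of_def)
  then show ?thesis by (auto simp: conflict_def)
qed

text \<open>A part whose members are twins lies in one interval, and so does its span. The parts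
  forming non-constant zones with \<open>X\<close> lie in the window of \<open>X\<close>, and so
  does the span of their union; a part in conflict with it therefore meets one of five intervals,
  each met by at most \<open>H\<close> parts.\<close>

lemma row_stretch_le:
  assumes sym: "\<forall>i<n. \<forall>j<n. M $$ (i, j) = M $$ (j, i)"
    and part: "partition_on {..<n} Q" and div: "division n p"
    and twins: "\<And>X i j. X \<in> Q \<Longrightarrow> i \<in> X \<Longrightarrow> j \<in> X \<Longrightarrow> twins M n p i j"
    and card: "\<And>a. card {X \<in> Q. X \<inter> fiber n p a \<noteq> {}} \<le> H"
    and X: "X \<in> Q"
  shows "row_stretch M Q X \<le> 5 * H"
proof -
  have sub: "Y \<subseteq> {..<n}" and ne: "Y \<noteq> {}" if "Y \<in> Q" for Y
    using part that by (auto simp: partition_on_def)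
  have fin: "finite Q" using part by (rule finite_elements[OF finite_lessThan])
  obtain x where x: "x \<in> X" using ne[OF X] by blast
  have xn: "x < n" using sub[OF X] x by auto
  define U where "U = \<Union> {C \<in> Q. C = X \<or> nonconstant_zone M X C}"
  have U_near: "near p x y" if "y \<in> U" for y
  proof (rule ccontr)
    assume far: "\<not> near p x y"
    from that obtain C where C: "C \<in> Q" "y \<in> C" "C = X \<or> nonconstant_zone M X C"
      by (auto simp: U_def)
    have "p z = p y" if "z \<in> C" for z using twins[OF C(1) that C(2)] by (simp add: twins_def)
    moreover have "p z = p x" if "z \<in> X" for z using twins[OF X that x] by (simp add: twins_def)
    ultimately have far': "\<not> near p i j" "\<not> near p j i" if "i \<in> X" "j \<in> C" for i j
      using far that unfolding near_def by metis+
    \<comment> \<open>Replace row i by the row of its twin x, transpose, replace row j by the row of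
      its twin y, and transpose back.\<close>
    have const: "M $$ (i, j) = M $$ (x, y)" if "i \<in> X" "j \<in> C" for i j
    proof -
      have ij: "i < n" "j < n" using that sub[OF X] sub[OF C(1)] by auto
      have "M $$ (i, j) = M $$ (x, j)"
        using twins[OF X that(1) x] far'(1)[OF that] ij by (auto simp: twins_def)
      also have "\<dots> = M $$ (j, x)" using sym ij xn by blast
      also have "\<dots> = M $$ (y, x)"
        using twins[OF C(1) that(2) C(2)] far'(2)[OF x that(2)] xn by (auto simp: twins_def)
      also have "\<dots> = M $$ (x, y)" using sym sub[OF C(1)] C(2) xn by auto
      finally show ?thesis .
    qed
    then have "\<not> nonconstant_zone M X C" unfolding nonconstant_zone_def by metis
    with C have "y \<in> X" by blast
    from twins[OF X x this] show False using far by (simp add: twins_def near_def)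
  qed
  have U: "U \<subseteq> {..<n}" "x \<in> U"
    using sub X x by (auto simp: U_def)
  then have finU: "finite U" "U \<noteq> {}" using finite_subset by auto
  let ?T = "\<lambda>a. {Y \<in> Q. Y \<inter> fiber n p a \<noteq> {}}"
  have mono: "p i \<le> p j" if "i \<le> j" "j < n" for i j using div that by (simp add: division_def)
  have "{Y \<in> Q. conflict Y U} \<subseteq> (\<Union>a\<in>{p x - 2..p x + 2}. ?T a)"
  proof
    fix Y assume "Y \<in> {Y \<in> Q. conflict Y U}"
    then have Y: "Y \<in> Q" and "span_of Y \<inter> span_of U \<noteq> {}"
      by (auto simp: conflict_def)
    then obtain z where "z \<in> span_of Y" "z \<in> span_of U" by blast
    then have z: "Min Y \<le> z" "z \<le> Max Y" "Min U \<le> z" "z \<le> Max U"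
      by (auto simp: span_of_def)
    have finY: "finite Y" using sub[OF Y] finite_subset by blast
    have Min: "Min Y \<in> Y" and Max: "Max Y \<in> Y" using ne[OF Y] finY by auto
    have Max_n: "Max Y < n" using Max sub[OF Y] by auto
    have "p (Min Y) = p (Max Y)" using twins[OF Y Min Max] by (simp add: twins_def)
    moreover have "p (Min Y) \<le> p z" "p z \<le> p (Max Y)"
      using mono[of "Min Y" z] mono[of z "Max Y"] z Max_n by auto
    ultimately have "p (Max Y) = p z" by simp
    moreover have "near p x (Min U)" "near p x (Max U)" using U_near finU by auto
    moreover have "p (Min U) \<le> p z" "p z \<le> p (Max U)"
      using mono[of "Min U" z] mono[of z "Max U"] z Max_n U(1) Max_in[OF finU] by auto
    ultimately have "p (Max Y) \<in> {p x - 2..p x + 2}" by (auto simp: near_def)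
    moreover have "Y \<in> ?T (p (Max Y))" using Y Max Max_n by (auto simp: fiber_def)
    ultimately show "Y \<in> (\<Union>a\<in>{p x - 2..p x + 2}. ?T a)" by blast
  qed
  then have "row_stretch M Q X \<le> card (\<Union>a\<in>{p x - 2..p x + 2}. ?T a)"
    unfolding row_stretch_def U_def[symmetric] by (intro card_mono) (use fin in auto)
  also have "\<dots> \<le> (\<Sum>a\<in>{p x - 2..p x + 2}. card (?T a))" by (intro card_UN_le) auto
  also have "\<dots> \<le> (\<Sum>a\<in>{p x - 2..p x + 2}. H)" by (intro sum_mono card)
  also have "\<dots> = 5 * H" by simp
  finally show ?thesis .
qed

lemma stretch_value_le:
  assumes sym: "\<forall>i<n. \<forall>j<n. M $$ (i, j) = M $$ (j, i)"
    and part: "partition_on {..<n} Q" and div: "division n p" and "1 \<le> n"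
    and "\<And>X i j. X \<in> Q \<Longrightarrow> i \<in> X \<Longrightarrow> j \<in> X \<Longrightarrow> twins M n p i j"
    and "\<And>a. card {X \<in> Q. X \<inter> fiber n p a \<noteq> {}} \<le> H"
  shows "stretch_value M (Q, Q) \<le> 5 * H"
proof -
  have "row_stretch M Q X \<le> 5 * H" "col_stretch M Q X \<le> 5 * H" if "X \<in> Q" for X
    using row_stretch_le[OF sym part div assms(5,6) that] col_stretch_eq_row_stretch[OF sym part that]
    by simp_all
  moreover have "finite Q" using part by (rule finite_elements[OF finite_lessThan])
  moreover have "0 \<in> \<Union> Q" using part assms(4) by (auto simp: partition_on_def)
  then have "Q \<noteq> {}" by blast
  ultimately show ?thesis by auto
qed

section \<open>Partition sequences and the existence of an admissible merge\<close>

lemma row_stretch_le_stretch_value: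
  assumes "partition_on {..<n} Q" and "X \<in> Q"
  shows "row_stretch M Q X \<le> stretch_value M (Q, Q)"
proof -
  have "finite Q" using assms(1) by (rule finite_elements[OF finite_lessThan])
  then show ?thesis using assms(2) by (auto intro!: Max_ge)
qed

text \<open>Each part conflicts with its own symmetric, so stretch values are never 0. This settles
  the report for nonpositive k.\<close>

lemma row_stretch_pos:
  assumes "partition_on {..<n} Q" and "X \<in> Q"
  shows "1 \<le> row_stretch M Q X"
proof -
  let ?U = "\<Union> {C \<in> Q. C = X \<or> nonconstant_zone M X C}"
  have "finite Q" using assms(1) by (rule finite_elements[OF finite_lessThan])
  have "?U \<subseteq> {..<n}" "X \<noteq> {}" using assms by (auto simp: partition_on_def)
  then have "conflict X ?U" using assms(2) by (intro conflict_subset) (auto intro: finite_subset)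
  then have "X \<in> {C' \<in> Q. conflict C' ?U}" using assms(2) by blast
  moreover have "finite {C' \<in> Q. conflict C' ?U}" using \<open>finite Q\<close> by simp
  ultimately show ?thesis
    unfolding row_stretch_def by (metis One_nat_def Suc_leI card_gt_0_iff empty_iff)
qed

text \<open>A merge step merges the same index sets on both sides, and both sides start from the
  singletons, so the row and column partitions coincide throughout.\<close>

lemma sequence_diagonal:
  assumes "symmetric_partition_sequence n Ps"
  obtains Q where "\<And>t. t < n \<Longrightarrow> Ps ! t = (Q t, Q t)"
    and "\<And>t. t < n \<Longrightarrow> partition_on {..<n} (Q t)"
    and "Q 0 = singletons n" and "Q (n - 1) = {{..<n}}"
    and "\<And>t. Suc t < n \<Longrightarrow> \<exists>A B. A \<in> Q t \<and> B \<in> Q t \<and> Q (Suc t) = merge_parts A B (Q t)"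
proof -
  have len: "length Ps = n" "Ps \<noteq> []" and hd: "hd Ps = (singletons n, singletons n)"
    and last: "card (fst (last Ps)) = 1" and succ: "successively merge_step Ps"
    and sym: "\<And>P. P \<in> set Ps \<Longrightarrow> symmetric_partition n P"
    using assms by (auto simp: symmetric_partition_sequence_def)
  define Q where "Q t = fst (Ps ! t)" for t
  have step: "merge_step (Ps ! t) (Ps ! Suc t)" if "Suc t < n" for t
    using succ that len by (simp add: successively_conv_nth)
  have diag: "Ps ! t = (Q t, Q t)" if "t < n" for t
    using that
  proof (induction t)
    case 0
    then show ?case using hd len by (simp add: Q_def hd_conv_nth)
  next
    case (Suc t)
    then obtain R where "Ps ! t = (R, R)" by auto
    then show ?case using step[OF Suc.prems]
      by (cases "Ps ! Suc t") (auto simp: Q_def)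
  qed
  have part: "partition_on {..<n} (Q t)" if "t < n" for t
  proof -
    have "Ps ! t \<in> set Ps" using that len by simp
    from sym[OF this] show ?thesis using diag[OF that] by simp
  qed
  have n: "0 < n" using len by auto
  have "card (Q (n - 1)) = 1" using last len by (simp add: last_conv_nth Q_def)
  then obtain Z where "Q (n - 1) = {Z}" by (auto simp: card_1_singleton_iff)
  moreover have "\<Union> (Q (n - 1)) = {..<n}" using part[of "n - 1"] n by (simp add: partition_on_def)
  ultimately have "Q (n - 1) = {{..<n}}" by simp
  moreover have "Q 0 = singletons n" using hd len by (simp add: Q_def hd_conv_nth)
  moreover have "\<exists>A B. A \<in> Q t \<and> B \<in> Q t \<and> Q (Suc t) = merge_parts A B (Q t)" if "Suc t < n" for t
    using step[OF that] diag[of t] diag[OF that] that by auto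
  ultimately show ?thesis using that diag part by blast
qed

lemma exists_mergeable:
  assumes seq: "symmetric_partition_sequence n Ps"
    and k: "\<And>P. P \<in> set Ps \<Longrightarrow> stretch_value M P \<le> k"
    and div: "division n p" and pos: "0 < p (n - 1)" and n: "1 \<le> n"
  shows "\<exists>a. 0 \<le> a \<and> a < p (n - 1) \<and> card (leaders M n (merge_fibers a p) a) \<le> k + 2"
proof -
  obtain Q where diag: "\<And>t. t < n \<Longrightarrow> Ps ! t = (Q t, Q t)"
    and part: "\<And>t. t < n \<Longrightarrow> partition_on {..<n} (Q t)"
    and Q0: "Q 0 = singletons n" and Qlast: "Q (n - 1) = {{..<n}}"
    and step: "\<And>t. Suc t < n \<Longrightarrow> \<exists>A B. A \<in> Q t \<and> B \<in> Q t \<and> Q (Suc t) = merge_parts A B (Q t)"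
    using sequence_diagonal[OF seq] by metis
  have mono: "p i \<le> p j" if "i \<le> j" "j < n" for i j using div that by (simp add: division_def)
  define red where "red t X = \<Union> {C \<in> Q t. C = X \<or> nonconstant_zone M X C}" for t X
  define F where "F a = fiber n p a \<union> fiber n p (a + 1)" for a
  define big where "big t \<longleftrightarrow> (\<exists>X\<in>Q t. \<exists>a. 0 \<le> a \<and> a < p (n - 1) \<and> F a \<subseteq> span_of (red t X))" for t
  have "\<not> big 0"
  proof
    assume "big 0"
    then obtain i a where i: "i < n" and a: "0 \<le> a" "a < p (n - 1)" "F a \<subseteq> span_of (red 0 {i})"
      by (auto simp: big_def Q0 singletons_def)
    \<comment> \<open>A zone of two singletons has one entry and is constant; and one index cannot
      lie in two intervals.\<close>
    have "red 0 {i} = {i}"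
      using i by (auto simp: red_def Q0 singletons_def nonconstant_zone_def)
    then have "F a \<subseteq> {i}" using a(3) by (simp add: span_of_def)
    moreover obtain x where x: "x \<in> fiber n p a"
      using fiber_nonempty[OF div, of a] a n by auto
    moreover obtain y where y: "y \<in> fiber n p (a + 1)"
      using fiber_nonempty[OF div, of "a + 1"] a n by auto
    ultimately have "x = y" by (auto simp: F_def)
    with x y show False by (simp add: fiber_def)
  qed
  moreover have "big (n - 1)"
  proof -
    have "red (n - 1) {..<n} = {..<n}" unfolding red_def Qlast by auto
    moreover have "Min {..<n} = 0" "Max {..<n} = n - 1"
      using n by (auto intro!: Min_eqI Max_eqI)
    ultimately have "span_of (red (n - 1) {..<n}) = {0..n - 1}" by (simp only: span_of_def)
    moreover have "F 0 \<subseteq> {0..n - 1}" by (auto simp: F_def fiber_def)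
    ultimately have "F 0 \<subseteq> span_of (red (n - 1) {..<n})" by (simp only:)
    then show ?thesis
      unfolding big_def Qlast using pos by (intro bexI[of _ "{..<n}"] exI[of _ 0] conjI) simp_all
  qed
  \<comment> \<open>Any switch from false to true will do; \<open>big\<close> need not be monotone
    in t.\<close>
  ultimately have "\<exists>t. Suc t < n \<and> \<not> big t \<and> big (Suc t)"
  proof -
    assume start: "\<not> big 0" and stop: "big (n - 1)"
    show ?thesis
    proof (rule ccontr)
      assume no: "\<nexists>t. Suc t < n \<and> \<not> big t \<and> big (Suc t)"
      have "\<not> big t" if "t < n" for t
        using that
      proof (induction t)
        case 0
        show ?case by fact
      next
        case (Suc t)
        then show ?case using no by auto
      qed
      with stop n show False by simp
    qed
  qed
  then obtain t where t: "Suc t < n" "\<not> big t" "big (Suc t)" by blast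
  from t(3) obtain X a where X: "X \<in> Q (Suc t)" and a: "0 \<le> a" "a < p (n - 1)"
    and F: "F a \<subseteq> span_of (red (Suc t) X)"
    by (auto simp: big_def)
  have tn: "t < n" using t by simp
  obtain A B where AB: "Q (Suc t) = merge_parts A B (Q t)" using step[OF t(1)] by blast
  define S where "S = {C \<in> Q (Suc t). conflict C (red (Suc t) X)}"
  have "finite (Q (Suc t))" using part[OF t(1)] by (rule finite_elements[OF finite_lessThan])
  then have finS: "finite S" by (simp add: S_def)
  have "Ps ! Suc t \<in> set Ps" using t(1) seq by (simp add: symmetric_partition_sequence_def)
  from k[OF this] have "stretch_value M (Q (Suc t), Q (Suc t)) \<le> k"
    unfolding diag[OF t(1)] .
  moreover have "row_stretch M (Q (Suc t)) X = card S"
    by (simp add: row_stretch_def S_def red_def)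
  ultimately have "card S \<le> k"
    using row_stretch_le_stretch_value[OF part[OF t(1)] X, of M] by linarith
  define T where "T = {C \<in> Q t. C \<inter> F a \<noteq> {}}"
  have fin: "finite C" if "C \<in> Q t" for C
  proof -
    have "C \<subseteq> {..<n}" using part[OF tn] that by (auto simp: partition_on_def)
    then show ?thesis by (rule finite_subset) simp
  qed
  \<comment> \<open>A part of \<open>Q t\<close> other than \<open>A\<close> and \<open>B\<close>
    survives in \<open>Q (Suc t)\<close>, where the bound k applies; the two exceptions account for
    k + 2.\<close>
  have "T \<subseteq> insert A (insert B S)"
  proof
    fix C assume "C \<in> T"
    then obtain z where C: "C \<in> Q t" "z \<in> C" "z \<in> F a" by (auto simp: T_def)
    have "z \<in> span_of C" using C fin by (auto simp: span_of_def)
    then have "conflict C (red (Suc t) X)" using C(3) F by (auto simp: conflict_def)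
    then show "C \<in> insert A (insert B S)" using C by (auto simp: S_def AB merge_parts_def)
  qed
  then have finT: "finite T" and "card T \<le> card (insert A (insert B S))"
    using finS by (auto intro: finite_subset card_mono)
  then have cardT: "card T \<le> k + 2"
    using \<open>card S \<le> k\<close> card_insert_le_m1[of _ "insert B S" A] finS
    by (simp add: card_insert_if split: if_splits)
  let ?p = "merge_fibers a p"
  have fiber: "p i = a \<or> p i = a + 1" if "?p i = a" for i
    using that by (auto simp: merge_fibers_def split: if_splits)
  \<comment> \<open>Only indices of the merged interval are compared: a part of \<open>Q t\<close>
    may reach into other intervals, which a twin class never does.\<close>
  have twins: "twins M n ?p i j" if C: "C \<in> Q t" "i \<in> C" "j \<in> C" and pi: "?p i = a" "?p j = a" for C i j
  proof -
    have "near ?p i c \<or> M $$ (i, c) = M $$ (j, c)" if c: "c < n" for c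
    proof (rule ccontr)
      assume *: "\<not> (near ?p i c \<or> M $$ (i, c) = M $$ (j, c))"
      obtain C' where C': "C' \<in> Q t" "c \<in> C'"
        using part[OF tn] c by (auto simp: partition_on_def)
      have "nonconstant_zone M C C'"
        using * C C' by (auto simp: nonconstant_zone_def)
      then have red: "i \<in> red t C" "c \<in> red t C" using C C' by (auto simp: red_def)
      have "red t C \<subseteq> {..<n}" using part[OF tn] by (auto simp: red_def partition_on_def)
      then have finr: "finite (red t C)" using finite_subset by blast
      have i: "i < n" using \<open>red t C \<subseteq> {..<n}\<close> red by auto
      have nb: "\<not> (F b \<subseteq> span_of (red t C))" if "0 \<le> b" "b < p (n - 1)" for b
        using t(2) C(1) that by (auto simp: big_def)
      have between: "x \<in> span_of (red t C)" if "y \<in> red t C" "z \<in> red t C" "y \<le> x" "x \<le> z" for x y z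
        using that finr by (simp add: span_of_def) (meson Max_ge Min_le le_trans)
      \<comment> \<open>In the old numbering an index outside the window lies at
        \<open>a + 4\<close> or more, or at \<open>a - 3\<close> or less; the asymmetry is the shift
        by one above \<open>a\<close>. So the intervals \<open>a + 2\<close> and
        \<open>a + 3\<close>, or \<open>a - 2\<close> and \<open>a - 1\<close>, lie strictly between
        i and c and would be contained in \<open>span_of (red t C)\<close>.\<close>
      consider "p c \<ge> a + 4" | "p c \<le> a - 3"
        using * pi(1) by (fastforce simp: near_def merge_fibers_def split: if_splits)
      then show False
      proof cases
        case 1
        have "F (a + 2) \<subseteq> span_of (red t C)"
        proof
          fix x assume "x \<in> F (a + 2)"
          then have "x < n" "p i < p x" "p x < p c" using 1 fiber[OF pi(1)] by (auto simp: F_def fiber_def)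
          then have "i \<le> x" "x \<le> c" using mono[of x i] mono[of c x] i c by (meson leD nle_le)+
          then show "x \<in> span_of (red t C)" using between red by blast
        qed
        then show False using nb[of "a + 2"] a 1 division_bounds[OF div c] by simp
      next
        case 2
        have "F (a - 2) \<subseteq> span_of (red t C)"
        proof
          fix x assume "x \<in> F (a - 2)"
          then have "x < n" "p c < p x" "p x < p i" using 2 fiber[OF pi(1)] by (auto simp: F_def fiber_def)
          then have "c \<le> x" "x \<le> i" using mono[of x c] mono[of i x] i c by (meson leD nle_le)+
          then show "x \<in> span_of (red t C)" using between red by blast
        qed
        then show False using nb[of "a - 2"] a 2 division_bounds[OF div c] by simp
      qed
    qed
    then show ?thesis using pi by (simp add: twins_def)
  qed
  \<comment> \<open>Each leader is sent to its part of \<open>Q t\<close>. Two leaders in a common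
    part would be twins, so distinct leaders use distinct parts, all of which meet the two
    intervals.\<close>
  define f where "f i = (SOME C. C \<in> Q t \<and> i \<in> C)" for i
  have f: "f i \<in> Q t" "i \<in> f i" if "i < n" for i
  proof -
    have "\<exists>C. C \<in> Q t \<and> i \<in> C" using part[OF tn] that by (auto simp: partition_on_def)
    from someI_ex[OF this] show "f i \<in> Q t" "i \<in> f i" by (auto simp: f_def)
  qed
  have leader: "i < n" "?p i = a" "i \<in> F a" if "i \<in> leaders M n ?p a" for i
    using that fiber[of i] by (auto simp: leaders_def fiber_def F_def)
  have "inj_on f (leaders M n ?p a)"
  proof
    fix i j assume ij: "i \<in> leaders M n ?p a" "j \<in> leaders M n ?p a" "f i = f j"
    then have "twins M n ?p i j" using twins f leader by metis
    with ij(1,2) twins_sym[OF this] show "i = j"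
      by (cases i j rule: linorder_cases) (auto simp: leaders_def)
  qed
  moreover have "f i \<in> T" if "i \<in> leaders M n ?p a" for i
    using f[OF leader(1)[OF that]] leader(3)[OF that] unfolding T_def by blast
  then have "f ` leaders M n ?p a \<subseteq> T" by blast
  ultimately have "card (leaders M n ?p a) \<le> card T" by (rule card_inj_on_le[OF _ _ finT])
  with cardT have "card (leaders M n ?p a) \<le> k + 2" by (rule order_trans[rotated])
  with a show ?thesis by blast
qed

section \<open>Partitions given by labels, and traces of merges\<close>

lemma partition_on_partition_of_labels: "partition_on {..<n} (partition_of_labels n g)"
  unfolding partition_on_def disjoint_def partition_of_labels_def by auto

lemma partition_of_labels_cong:
  "(\<And>i. i < n \<Longrightarrow> g i = h i) \<Longrightarrow> partition_of_labels n g = partition_of_labels n h"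
  unfolding partition_of_labels_def by (rule image_cong[OF refl]) (simp cong: conj_cong)

definition level :: "nat \<Rightarrow> (nat \<Rightarrow> int) \<Rightarrow> int \<Rightarrow> nat set" where
  "level n g v = {c. c < n \<and> g c = v}"

lemma partition_of_labels_level: "partition_of_labels n g = level n g ` g ` {..<n}"
  unfolding partition_of_labels_def level_def image_image ..

text \<open>Parts correspond bijectively to the labels in use, so they can be counted and removed on
  the side of the labels.\<close>

lemma inj_on_level: "inj_on (level n g) (g ` {..<n})"
proof
  fix v w assume v: "v \<in> g ` {..<n}" and eq: "level n g v = level n g w"
  from v obtain c where "c < n" "g c = v" by blast
  then have "c \<in> level n g w" using eq by (auto simp: level_def)
  then show "v = w" using \<open>g c = v\<close> by (simp add: level_def)
qed

lemma card_partition_of_labels: "card (partition_of_labels n g) = card (g ` {..<n})"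
  unfolding partition_of_labels_level by (rule card_image[OF inj_on_level])

lemma partition_of_labels_inj:
  "inj_on g {..<n} \<Longrightarrow> partition_of_labels n g = singletons n"
  unfolding partition_of_labels_def singletons_def
  by (rule image_cong[OF refl]) (auto simp: inj_on_def)

text \<open>Links the two ways of counting: the invariant of the program bounds labels in an
  interval, while the stretch estimate needs a bound on parts.\<close>

lemma card_parts_meeting:
  "card {X \<in> partition_of_labels n g. X \<inter> fiber n p a \<noteq> {}} \<le> card (g ` fiber n p a)"
proof -
  have "{X \<in> partition_of_labels n g. X \<inter> fiber n p a \<noteq> {}} \<subseteq> level n g ` g ` fiber n p a"
  proof
    fix X assume "X \<in> {X \<in> partition_of_labels n g. X \<inter> fiber n p a \<noteq> {}}"
    then obtain v c where "X = level n g v" "c \<in> X" "c \<in> fiber n p a"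
      by (auto simp: partition_of_labels_level)
    moreover from this have "v = g c" by (simp add: level_def)
    ultimately show "X \<in> level n g ` g ` fiber n p a" by blast
  qed
  then show ?thesis by (meson card_image_le card_mono finite_fiber finite_imageI le_trans)
qed

definition relabel :: "int \<Rightarrow> int \<Rightarrow> int \<Rightarrow> int" where
  "relabel x y v = (if v = y then x else v)"

text \<open>Overwriting the label of j by that of i empties one level set, enlarges another to the
  union of the two and leaves all others alone.\<close>

lemma merge_step_relabel:
  assumes "i < n" and "j < n" and "g i \<noteq> g j"
  defines "h \<equiv> \<lambda>c. relabel (g i) (g j) (g c)"
  shows "merge_step (partition_of_labels n g, partition_of_labels n g)
      (partition_of_labels n h, partition_of_labels n h)"
    and "Suc (card (partition_of_labels n h)) = card (partition_of_labels n g)"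
proof -
  let ?A = "level n g (g i)" and ?B = "level n g (g j)" and ?V = "g ` {..<n}"
  have ij: "g i \<in> ?V" "g j \<in> ?V" using assms(1,2) by blast+
  have img: "h ` {..<n} = ?V - {g j}"
  proof (intro equalityI subsetI)
    fix v assume "v \<in> h ` {..<n}"
    then show "v \<in> ?V - {g j}" using assms(1,3) by (auto simp: h_def relabel_def)
  next
    fix v assume "v \<in> ?V - {g j}"
    then obtain c where "c < n" "v = g c" "g c \<noteq> g j" by blast
    then have "c < n" "v = h c" by (simp_all add: h_def relabel_def)
    then show "v \<in> h ` {..<n}" by blast
  qed
  have A: "level n h (g i) = ?A \<union> ?B"
    by (auto simp: level_def h_def relabel_def)
  have other: "level n h v = level n g v" if "v \<in> ?V - {g i, g j}" for v
  proof -
    have "h c = v \<longleftrightarrow> g c = v" for c using that by (auto simp: h_def relabel_def)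
    then show ?thesis by (simp add: level_def)
  qed
  have "V - {w} = insert v (V - {v, w})" if "v \<in> V" "v \<noteq> w" for V and v w :: int
    using that by auto
  from this[OF ij(1) assms(3)] have "?V - {g j} = insert (g i) (?V - {g i, g j})" .
  then have "partition_of_labels n h = insert (?A \<union> ?B) (level n h ` (?V - {g i, g j}))"
    unfolding partition_of_labels_level[of n h] img by (simp add: A)
  also have "level n h ` (?V - {g i, g j}) = level n g ` (?V - {g i, g j})"
    using other by (rule image_cong[OF refl])
  also have "\<dots> = level n g ` ?V - level n g ` {g i, g j}"
    by (rule inj_on_image_set_diff[OF inj_on_level]) (use ij in auto)
  finally have "partition_of_labels n h = merge_parts ?A ?B (partition_of_labels n g)"
    by (simp add: merge_parts_def partition_of_labels_level)
  moreover have "?A \<in> partition_of_labels n g" "?B \<in> partition_of_labels n g"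
    unfolding partition_of_labels_level using ij by blast+
  moreover have "?A \<noteq> ?B" using inj_onD[OF inj_on_level _ ij] assms(3) by blast
  ultimately show "merge_step (partition_of_labels n g, partition_of_labels n g)
      (partition_of_labels n h, partition_of_labels n h)"
    unfolding merge_step.simps by blast
  show "Suc (card (partition_of_labels n h)) = card (partition_of_labels n g)"
    unfolding card_partition_of_labels img using ij by (simp add: card_Suc_Diff1 del: card_Diff_insert)
qed

text \<open>The last equation ties merges to parts: n - 1 merges reach a single part and,
  conversely, a single part is reached only after n - 1 merges. Both directions are used.\<close>

definition merge_trace :: "nat \<Rightarrow> (nat \<Rightarrow> nat \<Rightarrow> int) \<Rightarrow> nat \<Rightarrow> bool" where
  "merge_trace n f e \<longleftrightarrow>
     partition_of_labels n (f 0) = singletons n \<and>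
     (\<forall>t<e. merge_step (partition_of_labels n (f t), partition_of_labels n (f t))
       (partition_of_labels n (f (Suc t)), partition_of_labels n (f (Suc t)))) \<and>
     card (partition_of_labels n (f e)) + e = n"

lemma merge_trace_0: "inj_on (f 0) {..<n} \<Longrightarrow> merge_trace n f 0"
  by (simp add: merge_trace_def partition_of_labels_inj singletons_def card_image inj_on_def)

text \<open>\<open>f'\<close> has to agree with \<open>f\<close> only on the cells already in use,
  since traces are read off an output array that is still being extended.\<close>

lemma merge_trace_Suc:
  assumes "merge_trace n f e" and "i < n" and "j < n" and "f e i \<noteq> f e j"
    and "\<And>t c. t \<le> e \<Longrightarrow> c < n \<Longrightarrow> f' t c = f t c"
    and "\<And>c. c < n \<Longrightarrow> f' (Suc e) c = relabel (f e i) (f e j) (f e c)"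
  shows "merge_trace n f' (Suc e)"
proof -
  have old: "partition_of_labels n (f' t) = partition_of_labels n (f t)" if "t \<le> e" for t
    by (rule partition_of_labels_cong) (use assms(5) that in auto)
  have new: "partition_of_labels n (f' (Suc e)) =
      partition_of_labels n (\<lambda>c. relabel (f e i) (f e j) (f e c))"
    by (rule partition_of_labels_cong) (use assms(6) in auto)
  note step = merge_step_relabel[of i n j "f e", OF assms(2-4)]
  show ?thesis
    using assms(1) step old new unfolding merge_trace_def
    by (auto simp: less_Suc_eq simp del: merge_step.simps)
qed

lemma merge_trace_sequence:
  assumes "merge_trace n f (n - 1)" and "1 \<le> n"
  shows "symmetric_partition_sequence n
    (map (\<lambda>t. (partition_of_labels n (f t), partition_of_labels n (f t))) [0..<n])"
proof -
  let ?P = "\<lambda>t. (partition_of_labels n (f t), partition_of_labels n (f t))"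
  let ?Ps = "map ?P [0..<n]"
  have ends: "hd ?Ps = ?P 0" "last ?Ps = ?P (n - 1)" and ne: "?Ps \<noteq> []"
    using assms(2) by (simp_all add: hd_map last_map hd_upt last_upt)
  have "merge_step (?P t) (?P (Suc t))" if "Suc t < n" for t
    using assms(1) that unfolding merge_trace_def by (simp del: merge_step.simps)
  then have succ: "successively merge_step ?Ps"
    by (simp add: successively_conv_nth del: merge_step.simps)
  have sym: "symmetric_partition n P" if "P \<in> set ?Ps" for P
    using that partition_on_partition_of_labels by auto
  have "card (partition_of_labels n (f (n - 1))) + (n - 1) = n"
    and "partition_of_labels n (f 0) = singletons n"
    using assms(1) by (simp_all only: merge_trace_def)
  moreover from this(1) have "card (partition_of_labels n (f (n - 1))) = 1"
    using assms(2) by linarith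
  ultimately have "card (partition_of_labels n (f (n - 1))) = 1"
    and "partition_of_labels n (f 0) = singletons n" by blast+
  with ends ne succ sym show ?thesis
    unfolding symmetric_partition_sequence_def by (simp del: merge_step.simps symmetric_partition.simps)
qed

text \<open>Ensures that the infimum in \<open>stw\<close> ranges over a non-empty set. The witness
  has merged 0, ..., t into one part at time t.\<close>

lemma symmetric_partition_sequence_exists:
  assumes "1 \<le> n"
  shows "\<exists>Ps. symmetric_partition_sequence n Ps"
proof -
  define f where "f t i = (if i \<le> t then 0 else int i)" for t i :: nat
  have "merge_trace n f e" if "e < n" for e
    using that
  proof (induction e)
    case 0
    show ?case by (rule merge_trace_0) (auto simp: f_def inj_on_def split: if_splits)
  next
    case (Suc e)
    then have "merge_trace n f e" by simp
    then show ?case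
      by (rule merge_trace_Suc[of n f e 0 "Suc e"]) (use Suc.prems in \<open>auto simp: f_def relabel_def\<close>)
  qed
  from this[of "n - 1"] assms show ?thesis using merge_trace_sequence[of n f] by auto
qed

text \<open>The infimum of a non-empty set of naturals is attained, so it suffices to refute each
  sequence separately.\<close>

lemma stw_greater:
  assumes "dim_row M = n" and "1 \<le> n"
    and "\<And>Ps. symmetric_partition_sequence n Ps \<Longrightarrow> \<exists>P\<in>set Ps. k < int (stretch_value M P)"
  shows "k < int (stw M)"
proof -
  let ?V = "{Max (stretch_value M ` set Ps) | Ps. symmetric_partition_sequence (dim_row M) Ps}"
  have "?V \<noteq> {}" using symmetric_partition_sequence_exists[OF assms(2)] assms(1) by auto
  then have "Inf ?V \<in> ?V" by (rule Inf_nat_def1)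
  then obtain Ps where Ps: "stw M = Max (stretch_value M ` set Ps)" "symmetric_partition_sequence n Ps"
    unfolding stw_def assms(1) by auto
  from assms(3)[OF Ps(2)] obtain P where P: "P \<in> set Ps" "k < int (stretch_value M P)" by blast
  moreover have "stretch_value M P \<le> stw M" unfolding Ps(1) using P(1) by (intro Max_ge) auto
  ultimately show ?thesis by simp
qed

section \<open>The program and its invariants\<close>

definition equal :: "aexp \<Rightarrow> aexp \<Rightarrow> bexp" where
  "equal e f = Conj (Leq e f) (Leq f e)"

lemma bval_equal [simp]: "bval (equal e f) s \<longleftrightarrow> aval e s = aval f s"
  by (auto simp: equal_def)

text \<open>
  The array \<open>p\<close> holds the interval number of each index and \<open>q\<close> the one after a tentative merge,
  \<open>L\<close> holds the current part labels, and \<open>mul\<close> the multiples of n, as there is no multiplication.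
  The last partition written to the output has number \<open>t\<close>, and \<open>base\<close> is t * n.
\<close>

definition difference :: "name \<Rightarrow> loop" where
  "difference p = indicator ''v''
     (Conj
       (Neg (Conj (Leq (Read p (Var ''c'')) (Add (Read p (Var ''i'')) (Lit 2)))
          (Leq (Read p (Var ''i'')) (Add (Read p (Var ''c'')) (Lit 2)))))
       (Neg (equal (Read ''M'' (Add (Read ''mul'' (Var ''i'')) (Var ''c'')))
          (Read ''M'' (Add (Read ''mul'' (Var ''j'')) (Var ''c''))))))"

definition differences :: "name \<Rightarrow> loop" where
  "differences p = tally ''d'' ''c'' (difference p) ''v''"

definition earlier_twin :: "name \<Rightarrow> loop" where
  "earlier_twin p =
     LSeq (differences p)
       (indicator ''w''
         (Conj (Neg (Leq (Var ''i'') (Var ''j'')))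
           (Conj (equal (Read p (Var ''i'')) (Read p (Var ''j''))) (Leq (Var ''d'') (Lit 0)))))"

definition earlier_twins :: "name \<Rightarrow> loop" where
  "earlier_twins p = tally ''b'' ''j'' (earlier_twin p) ''w''"

definition leader :: "name \<Rightarrow> loop" where
  "leader p =
     LSeq (earlier_twins p)
       (indicator ''x''
         (Conj (equal (Read p (Var ''i'')) (Var ''a'')) (Leq (Var ''b'') (Lit 0))))"

definition count_classes :: "name \<Rightarrow> loop" where
  "count_classes p = tally ''m'' ''i'' (leader p) ''x''"

definition try_merge :: loop where
  "try_merge =
     LSeq (For ''i''
       (LCond (Leq (Read ''p'' (Var ''i'')) (Var ''a''))
         (LWrite ''q'' (Var ''i'') (Read ''p'' (Var ''i'')))
         (LWrite ''q'' (Var ''i'') (Sub (Read ''p'' (Var ''i'')) (Lit 1)))))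
     (LSeq (count_classes ''q'')
       (LCond (Leq (Var ''m'') (Add (Var ''k'') (Lit 2)))
         (For ''i'' (LWrite ''p'' (Var ''i'') (Read ''q'' (Var ''i''))))
         LSkip))"

definition emit :: loop where
  "emit = For ''c''
     (LSeq (LCond (equal (Read ''L'' (Var ''c'')) (Var ''y'')) (LWrite ''L'' (Var ''c'') (Var ''x'')) LSkip)
     (LSeq (LWrite ''rows'' (Add (Var ''base'') (Var ''c'')) (Read ''L'' (Var ''c'')))
       (LWrite ''cols'' (Add (Var ''base'') (Var ''c'')) (Read ''L'' (Var ''c'')))))"

text \<open>Both labels are saved first, because \<open>emit\<close> overwrites the label of j
  before its scan is over. Adding n to \<open>base\<close> replaces multiplying the partition number
  by n.\<close>

definition merge_labels :: loop where
  "merge_labels =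
     LSeq (LAssign ''x'' (Read ''L'' (Var ''i'')))
     (LSeq (LAssign ''y'' (Read ''L'' (Var ''j'')))
     (LSeq (LAssign ''base'' (Add (Var ''base'') (Var ''n'')))
     (LSeq (LAssign ''t'' (Add (Var ''t'') (Lit 1)))
       emit)))"

definition merge_if_twins :: loop where
  "merge_if_twins =
     LSeq (differences ''p'')
       (LCond
         (Conj (equal (Read ''p'' (Var ''i'')) (Read ''p'' (Var ''j'')))
           (Conj (Leq (Var ''d'') (Lit 0))
             (Neg (equal (Read ''L'' (Var ''i'')) (Read ''L'' (Var ''j''))))))
         merge_labels LSkip)"

definition close :: loop where
  "close = For ''i'' (For ''j'' merge_if_twins)"

text \<open>The partition into singletons is already output here. The variables \<open>t\<close>,
  \<open>base\<close> and \<open>z\<close> need no initial assignment, as memory outside the input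
  is zero.\<close>

definition initialize :: loop where
  "initialize = For ''i''
     (LSeq (LWrite ''mul'' (Var ''i'') (Var ''z''))
     (LSeq (LAssign ''z'' (Add (Var ''z'') (Var ''n'')))
     (LSeq (LWrite ''p'' (Var ''i'') (Var ''i''))
     (LSeq (LWrite ''L'' (Var ''i'') (Var ''i''))
     (LSeq (LWrite ''rows'' (Var ''i'') (Var ''i''))
       (LWrite ''cols'' (Var ''i'') (Var ''i'')))))))"

text \<open>A bounded form of repeating until no merge is possible: a round without success shows
  that no merge is admissible, and at most n - 1 rounds can succeed, so n rounds are enough.\<close>

definition main_loop :: loop where
  "main_loop = For ''u'' (For ''a'' (LSeq try_merge close))"

text \<open>\<open>t\<close> numbers the last partition written, so all n partitions are present
  once \<open>t + 1\<close> reaches n. A nonpositive k is always exceeded; the loops still run in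
  that case, but without the invariants, which speak of a natural number k.\<close>

definition report :: loop where
  "report =
     LCond (Conj (Leq (Lit 1) (Var ''k'')) (Leq (Var ''n'') (Add (Var ''t'') (Lit 1))))
       (LAssign ''answer'' (Lit 1)) (LAssign ''answer'' (Lit 0))"

definition program :: loop where
  "program = LSeq initialize (LSeq main_loop report)"

text \<open>With explicit footprints, \<open>fst_run\<close> and \<open>snd_run\<close> settle frame
  conditions by simplification.\<close>

lemma vars_simps [simp]:
  "vars (difference p) = {''v''}"
  "vars (earlier_twin p) = {''d'', ''c'', ''v'', ''w''}"
  "vars (leader p) = {''b'', ''j'', ''d'', ''c'', ''v'', ''w'', ''x''}"
  "vars (differences p) = {''d'', ''c'', ''v''}"
  "vars (earlier_twins p) = {''b'', ''j'', ''d'', ''c'', ''v'', ''w''}"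
  "vars (count_classes p) = {''m'', ''i'', ''b'', ''j'', ''d'', ''c'', ''v'', ''w'', ''x''}"
  "vars try_merge = {''m'', ''i'', ''b'', ''j'', ''d'', ''c'', ''v'', ''w'', ''x''}"
  "vars emit = {''c''}"
  "vars merge_labels = {''x'', ''y'', ''base'', ''t'', ''c''}"
  "vars merge_if_twins = {''d'', ''v'', ''x'', ''y'', ''base'', ''t'', ''c''}"
  "vars close = {''i'', ''j'', ''d'', ''v'', ''x'', ''y'', ''base'', ''t'', ''c''}"
  "vars initialize = {''i'', ''z''}"
  by (auto simp: difference_def differences_def earlier_twin_def earlier_twins_def
      leader_def count_classes_def try_merge_def emit_def
      merge_labels_def merge_if_twins_def close_def initialize_def)

lemma arrays_simps [simp]:
  "arrays (difference p) = {}"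
  "arrays (earlier_twin p) = {}"
  "arrays (leader p) = {}"
  "arrays (differences p) = {}"
  "arrays (earlier_twins p) = {}"
  "arrays (count_classes p) = {}"
  "arrays try_merge = {''p'', ''q''}"
  "arrays emit = {''L'', ''rows'', ''cols''}"
  "arrays merge_labels = {''L'', ''rows'', ''cols''}"
  "arrays merge_if_twins = {''L'', ''rows'', ''cols''}"
  "arrays close = {''L'', ''rows'', ''cols''}"
  by (auto simp: difference_def differences_def earlier_twin_def earlier_twins_def
      leader_def count_classes_def try_merge_def emit_def
      merge_labels_def merge_if_twins_def close_def)

lemma well_formed_tallies [simp]:
  "well_formed (differences p)" "well_formed (earlier_twins p)" "well_formed (count_classes p)"
  by (simp_all add: count_classes_def leader_def earlier_twins_def earlier_twin_def
      differences_def difference_def)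

lemma well_formed_program: "well_formed program"
  by (simp add: program_def initialize_def main_loop_def report_def close_def merge_if_twins_def
      merge_labels_def emit_def try_merge_def)

lemma snd_run_no_arrays: "arrays p = {} \<Longrightarrow> snd (run p s) = snd s"
  by (intro ext) simp

section \<open>Correctness of the twin test and of the class count\<close>

definition stores :: "nat \<Rightarrow> state \<Rightarrow> name \<Rightarrow> (nat \<Rightarrow> int) \<Rightarrow> bool" where
  "stores n s x f \<longleftrightarrow> (\<forall>i<n. snd s x (int i) = f i)"

definition env :: "int mat \<Rightarrow> nat \<Rightarrow> nat \<Rightarrow> state \<Rightarrow> bool" where
  "env M n k s \<longleftrightarrow> fst s ''n'' = int n \<and> fst s ''k'' = int k \<and>
     stores n s ''mul'' (\<lambda>i. int (i * n)) \<and>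
     (\<forall>i<n. \<forall>j<n. snd s ''M'' (int (i * n + j)) = M $$ (i, j))"

lemma env_cong:
  assumes "env M n k s" and "\<And>x. x \<in> {''n'', ''k''} \<Longrightarrow> fst s' x = fst s x"
    and "\<And>x. x \<in> {''mul'', ''M''} \<Longrightarrow> snd s' x = snd s x"
  shows "env M n k s'"
  using assms by (simp add: env_def stores_def)

lemma sum_of_bool_le_0_iff: "(\<Sum>i<n. of_bool (P i)) \<le> (0 :: int) \<longleftrightarrow> (\<forall>i<n. \<not> P i)"
  for n :: nat
proof -
  have "(\<Sum>i<n. of_bool (P i)) = int (card ({..<n} \<inter> {i. P i}))"
    by (rule sum_of_bool_eq) simp_all
  then show ?thesis by (auto simp: card_eq_0_iff)
qed

lemma run_difference:
  assumes env: "env M n k s" and p: "stores n s x p" and i: "fst s ''i'' = int i" "i < n"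
    and j: "fst s ''j'' = int j" "j < n" and c: "fst s ''c'' = int c" "c < n"
  shows "fst (run (difference x) s) ''v'' = of_bool (\<not> (near p i c \<or> M $$ (i, c) = M $$ (j, c)))"
proof -
  have cell: "snd s ''M'' (int (r * n) + int c) = M $$ (r, c)" if "r < n" for r
    using env c(2) that unfolding env_def by (metis of_nat_add)
  have mul: "snd s ''mul'' (int r) = int (r * n)" if "r < n" for r
    using env that by (simp add: env_def stores_def)
  have "snd s x (int i) = p i" "snd s x (int c) = p c" using p i c by (simp_all add: stores_def)
  then show ?thesis
    using i j c by (simp add: difference_def cell mul near_def del: of_nat_mult)
qed

lemma run_differences:
  assumes env: "env M n k s" and p: "stores n s x p" and i: "fst s ''i'' = int i" "i < n"
    and j: "fst s ''j'' = int j" "j < n"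
  shows "fst (run (differences x) s) ''d'' \<le> 0 \<longleftrightarrow>
    (\<forall>c<n. near p i c \<or> M $$ (i, c) = M $$ (j, c))"
proof -
  have "fst (run (differences x) s) ''d'' = (\<Sum>c<n. of_bool (\<not> (near p i c \<or> M $$ (i, c) = M $$ (j, c))))"
    unfolding differences_def
  proof (rule run_tally)
    fix c s'
    assume c: "c < n" and s': "fst s' ''c'' = int c" "snd s' = snd s"
      and frame: "\<And>y. y \<notin> insert ''d'' (insert ''c'' (vars (difference x))) \<Longrightarrow> fst s' y = fst s y"
    have eq: "fst s' ''i'' = fst s ''i''" "fst s' ''j'' = fst s ''j''"
      "fst s' ''n'' = fst s ''n''" "fst s' ''k'' = fst s ''k''"
      using frame by simp_all
    show "fst (run (difference x) s') ''v'' = of_bool (\<not> (near p i c \<or> M $$ (i, c) = M $$ (j, c)))"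
      by (rule run_difference[where k = k])
        (use env p i j c s' eq in \<open>simp_all add: env_def stores_def\<close>)
  qed (use env in \<open>simp_all add: env_def difference_def\<close>)
  then show ?thesis by (simp only: sum_of_bool_le_0_iff) blast
qed

lemma run_earlier_twin:
  assumes "env M n k s" and p: "stores n s x p" and i: "fst s ''i'' = int i" "i < n"
    and j: "fst s ''j'' = int j" "j < n"
  shows "fst (run (earlier_twin x) s) ''w'' = of_bool (j < i \<and> twins M n p i j)"
  using run_differences[OF assms] p i j
  by (simp add: earlier_twin_def stores_def twins_def not_le)

lemma run_earlier_twins:
  assumes env: "env M n k s" and p: "stores n s x p" and i: "fst s ''i'' = int i" "i < n"
  shows "fst (run (earlier_twins x) s) ''b'' \<le> 0 \<longleftrightarrow> (\<forall>j<i. \<not> twins M n p j i)"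
proof -
  have "fst (run (earlier_twins x) s) ''b'' = (\<Sum>j<n. of_bool (j < i \<and> twins M n p i j))"
    unfolding earlier_twins_def
  proof (rule run_tally)
    fix j s'
    assume j: "j < n" and s': "fst s' ''j'' = int j" "snd s' = snd s"
      and frame: "\<And>y. y \<notin> insert ''b'' (insert ''j'' (vars (earlier_twin x))) \<Longrightarrow> fst s' y = fst s y"
    have eq: "fst s' ''i'' = fst s ''i''" "fst s' ''n'' = fst s ''n''" "fst s' ''k'' = fst s ''k''"
      using frame by simp_all
    show "fst (run (earlier_twin x) s') ''w'' = of_bool (j < i \<and> twins M n p i j)"
      by (rule run_earlier_twin[where k = k])
        (use env p i j s' eq in \<open>simp_all add: env_def stores_def\<close>)
  qed (use env in \<open>simp_all add: env_def earlier_twin_def\<close>)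
  then have "fst (run (earlier_twins x) s) ''b'' \<le> 0 \<longleftrightarrow> (\<forall>j<n. \<not> (j < i \<and> twins M n p i j))"
    by (simp only: sum_of_bool_le_0_iff)
  also have "\<dots> \<longleftrightarrow> (\<forall>j<i. \<not> twins M n p j i)"
    using i(2) twins_sym by (metis less_trans)
  finally show ?thesis .
qed

lemma run_leader:
  assumes "env M n k s" and p: "stores n s x p" and i: "fst s ''i'' = int i" "i < n"
    and a: "fst s ''a'' = a"
  shows "fst (run (leader x) s) ''x'' = of_bool (i \<in> leaders M n p a)"
  using run_earlier_twins[OF assms(1-4)] p i a
  by (simp add: leader_def stores_def leaders_def fiber_def)

lemma run_count_classes:
  assumes env: "env M n k s" and p: "stores n s x p" and a: "fst s ''a'' = a"
  shows "fst (run (count_classes x) s) ''m'' = int (card (leaders M n p a))"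
proof -
  have "fst (run (count_classes x) s) ''m'' = (\<Sum>i<n. of_bool (i \<in> leaders M n p a))"
    unfolding count_classes_def
  proof (rule run_tally)
    fix i s'
    assume i: "i < n" and s': "fst s' ''i'' = int i" "snd s' = snd s"
      and frame: "\<And>y. y \<notin> insert ''m'' (insert ''i'' (vars (leader x))) \<Longrightarrow> fst s' y = fst s y"
    have eq: "fst s' ''a'' = fst s ''a''" "fst s' ''n'' = fst s ''n''" "fst s' ''k'' = fst s ''k''"
      using frame by simp_all
    show "fst (run (leader x) s') ''x'' = of_bool (i \<in> leaders M n p a)"
      by (rule run_leader[where k = k])
        (use env p i s' eq a in \<open>simp_all add: env_def stores_def\<close>)
  qed (use env in \<open>simp_all add: env_def leader_def\<close>)
  also have "\<dots> = int (card ({..<n} \<inter> {i. i \<in> leaders M n p a}))"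
    by (rule sum_of_bool_eq) simp_all
  also have "{..<n} \<inter> {i. i \<in> leaders M n p a} = leaders M n p a"
    by (auto simp: leaders_def fiber_def)
  finally show ?thesis .
qed

section \<open>Tentative merges, emitted partitions and the invariant\<close>

lemma run_try_merge:
  assumes env: "env M n k s" and p: "stores n s ''p'' p" and a: "fst s ''a'' = a"
  shows "stores n (run try_merge s) ''p''
    (if card (leaders M n (merge_fibers a p) a) \<le> k + 2 then merge_fibers a p else p)"
proof -
  let ?fill = "For ''i'' (LCond (Leq (Read ''p'' (Var ''i'')) (Var ''a''))
     (LWrite ''q'' (Var ''i'') (Read ''p'' (Var ''i'')))
     (LWrite ''q'' (Var ''i'') (Sub (Read ''p'' (Var ''i'')) (Lit 1))))"
  let ?copy = "For ''i'' (LWrite ''p'' (Var ''i'') (Read ''q'' (Var ''i'')))"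
  have n: "fst s ''n'' = int n" using env by (simp add: env_def)
  define s1 where "s1 = run ?fill s"
  have q1: "stores n s1 ''q'' (merge_fibers a p)"
  proof -
    let ?I = "\<lambda>i s'. (\<forall>j<i. snd s' ''q'' (int j) = merge_fibers a p j) \<and>
      snd s' ''p'' = snd s ''p'' \<and> fst s' ''a'' = a"
    obtain s' where "?I n s'" "s1 = set_var ''i'' (int n) s'"
      unfolding s1_def
      by (rule run_For_invariant[where I = ?I, OF n])
        (use a p in \<open>auto simp: stores_def merge_fibers_def less_Suc_eq\<close>)
    then show ?thesis by (simp add: stores_def)
  qed
  have s1: "env M n k s1" "stores n s1 ''p'' p" "fst s1 ''a'' = a"
    unfolding s1_def using a p by (auto intro: env_cong[OF env] simp: stores_def)
  define s2 where "s2 = run (count_classes ''q'') s1"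
  have m: "fst s2 ''m'' = int (card (leaders M n (merge_fibers a p) a))"
    unfolding s2_def by (rule run_count_classes[OF s1(1) q1 s1(3)])
  have s2: "env M n k s2" "stores n s2 ''p'' p" "stores n s2 ''q'' (merge_fibers a p)"
    unfolding s2_def using s1 q1 by (auto intro: env_cong[OF s1(1)] simp: stores_def)
  have n2: "fst s2 ''n'' = int n" using s2(1) by (simp add: env_def)
  have k: "fst s ''k'' = int k" using env by (simp add: env_def)
  have copy: "stores n (run ?copy s2) ''p'' (merge_fibers a p)"
  proof -
    let ?I = "\<lambda>i s'. (\<forall>j<i. snd s' ''p'' (int j) = merge_fibers a p j) \<and> snd s' ''q'' = snd s2 ''q''"
    obtain s' where "?I n s'" "run ?copy s2 = set_var ''i'' (int n) s'"
      by (rule run_For_invariant[where I = ?I, OF n2])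
        (use s2(3) in \<open>auto simp: stores_def less_Suc_eq\<close>)
    then show ?thesis by (simp add: stores_def)
  qed
  have "run try_merge s = (if int (card (leaders M n (merge_fibers a p) a)) \<le> int k + 2 then run ?copy s2 else s2)"
    by (simp add: try_merge_def s1_def[symmetric] s2_def[symmetric] m k)
  then show ?thesis using copy s2(2) by (auto split: if_splits)
qed

text \<open>The stretch bound is recorded for every partition when it is written, because the
  division that certifies it is coarsened afterwards.\<close>

definition emitted :: "int mat \<Rightarrow> nat \<Rightarrow> nat \<Rightarrow> nat \<Rightarrow> state \<Rightarrow> bool" where
  "emitted M n b e s \<longleftrightarrow>
     fst s ''t'' = int e \<and> fst s ''base'' = int (e * n) \<and>
     (\<forall>t\<le>e. \<forall>c<n. snd s ''cols'' (int (t * n + c)) = snd s ''rows'' (int (t * n + c))) \<and>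
     stores n s ''L'' (\<lambda>c. snd s ''rows'' (int (e * n + c))) \<and>
     merge_trace n (\<lambda>t c. snd s ''rows'' (int (t * n + c))) e \<and>
     (\<forall>t\<le>e. let P = partition_of_labels n (\<lambda>c. snd s ''rows'' (int (t * n + c)))
       in stretch_value M (P, P) \<le> b)"

text \<open>\<open>g\<close> bounds the number of labels in each interval; it is a function because
  an interval just formed may hold twice as many as the others. As \<open>g\<close> stays within 2(k
  + 2), the five intervals of a window yield \<open>10 * (k + 2)\<close>.\<close>

definition invariant ::
  "int mat \<Rightarrow> nat \<Rightarrow> nat \<Rightarrow> (nat \<Rightarrow> int) \<Rightarrow> (int \<Rightarrow> nat) \<Rightarrow> state \<Rightarrow> bool" where
  "invariant M n k p g s \<longleftrightarrow> env M n k s \<and> stores n s ''p'' p \<and>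
     (\<exists>e. emitted M n (10 * (k + 2)) e s) \<and>
     (\<forall>i<n. \<forall>j<n. snd s ''L'' (int i) = snd s ''L'' (int j) \<longrightarrow> twins M n p i j) \<and>
     (\<forall>a. card ((\<lambda>c. snd s ''L'' (int c)) ` fiber n p a) \<le> g a)"

lemma invariant_cong:
  assumes "invariant M n k p g s"
    and "\<And>x. x \<in> {''n'', ''k'', ''t'', ''base''} \<Longrightarrow> fst s' x = fst s x"
    and "\<And>x. x \<in> {''mul'', ''M'', ''p'', ''L'', ''rows'', ''cols''} \<Longrightarrow> snd s' x = snd s x"
  shows "invariant M n k p g s'"
proof -
  have "env M n k s'" using assms by (simp add: invariant_def env_def stores_def)
  moreover have "emitted M n b e s' = emitted M n b e s" for b e
    using assms(2,3) by (simp add: emitted_def stores_def)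
  ultimately show ?thesis using assms(1,3) by (simp add: invariant_def stores_def)
qed

lemma run_emit:
  assumes n: "fst s ''n'' = int n" and x: "fst s ''x'' = x" and y: "fst s ''y'' = y"
    and base: "fst s ''base'' = int b"
  shows "\<And>c. c < n \<Longrightarrow> snd (run emit s) ''L'' (int c) = relabel x y (snd s ''L'' (int c))"
    and "\<And>z. A \<in> {''rows'', ''cols''} \<Longrightarrow> snd (run emit s) A (int z) =
      (if b \<le> z \<and> z < b + n then relabel x y (snd s ''L'' (int (z - b))) else snd s A (int z))"
proof -
  define L where "L c = snd s ''L'' (int c)" for c
  let ?I = "\<lambda>c s'. fst s' ''x'' = x \<and> fst s' ''y'' = y \<and> fst s' ''base'' = int b \<and>
    (\<forall>c'. snd s' ''L'' (int c') = (if c' < c then relabel x y (L c') else L c')) \<and>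
    (\<forall>A\<in>{''rows'', ''cols''}. \<forall>z. snd s' A (int z) =
      (if b \<le> z \<and> z < b + c then relabel x y (L (z - b)) else snd s A (int z)))"
  obtain s' where s': "?I n s'" "run emit s = set_var ''c'' (int n) s'"
    unfolding emit_def
  proof (rule run_For_invariant[where I = ?I, OF n])
    show "?I 0 s" using assms by (simp add: L_def)
    fix c s'
    assume "c < n" and I: "?I c s'"
    have eq: "int z = int b + int c \<longleftrightarrow> z = b + c" for z by auto
    show "?I (Suc c) (run (LSeq (LCond (equal (Read ''L'' (Var ''c'')) (Var ''y''))
          (LWrite ''L'' (Var ''c'') (Var ''x'')) LSkip)
        (LSeq (LWrite ''rows'' (Add (Var ''base'') (Var ''c'')) (Read ''L'' (Var ''c'')))
          (LWrite ''cols'' (Add (Var ''base'') (Var ''c'')) (Read ''L'' (Var ''c'')))))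
        (set_var ''c'' (int c) s'))"
      using I by (auto simp: relabel_def eq less_Suc_eq)
  qed
  show "snd (run emit s) ''L'' (int c) = relabel x y (snd s ''L'' (int c))" if "c < n" for c
    using s' that by (simp add: L_def)
  show "snd (run emit s) A (int z) =
      (if b \<le> z \<and> z < b + n then relabel x y (snd s ''L'' (int (z - b))) else snd s A (int z))"
    if "A \<in> {''rows'', ''cols''}" for z
    using s' that unfolding L_def[symmetric] by auto
qed

lemma partition_of_labels_related:
  "X \<in> partition_of_labels n h \<Longrightarrow> u \<in> X \<Longrightarrow> v \<in> X \<Longrightarrow> u < n \<and> v < n \<and> h u = h v"
  by (auto simp: partition_of_labels_def)

lemma stretch_value_labels_le:
  assumes sym: "\<forall>i<n. \<forall>j<n. M $$ (i, j) = M $$ (j, i)"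
    and "division n p" and "1 \<le> n"
    and twins: "\<And>u v. u < n \<Longrightarrow> v < n \<Longrightarrow> h u = h v \<Longrightarrow> twins M n p u v"
    and card: "\<And>a. card (h ` fiber n p a) \<le> H"
  shows "stretch_value M (partition_of_labels n h, partition_of_labels n h) \<le> 5 * H"
proof (rule stretch_value_le[OF sym partition_on_partition_of_labels assms(2,3)])
  show "twins M n p u v" if "X \<in> partition_of_labels n h" "u \<in> X" "v \<in> X" for X u v
    using partition_of_labels_related[OF that] twins by blast
  show "card {X \<in> partition_of_labels n h. X \<inter> fiber n p a \<noteq> {}} \<le> H" for a
    using card_parts_meeting card by (rule order_trans)
qed

lemma run_merge_labels:
  assumes sym: "\<forall>i<n. \<forall>j<n. M $$ (i, j) = M $$ (j, i)"
    and div: "division n p" and inv: "invariant M n k p g s" and g: "\<And>a. g a \<le> 2 * (k + 2)"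
    and i: "fst s ''i'' = int i" "i < n" and j: "fst s ''j'' = int j" "j < n"
    and ij: "twins M n p i j" "snd s ''L'' (int i) \<noteq> snd s ''L'' (int j)"
  defines "s' \<equiv> run merge_labels s"
  shows "invariant M n k p g s'"
    and "\<And>c. c < n \<Longrightarrow> snd s' ''L'' (int c) =
      relabel (snd s ''L'' (int i)) (snd s ''L'' (int j)) (snd s ''L'' (int c))"
proof -
  define L where "L c = snd s ''L'' (int c)" for c
  define lab where "lab = (\<lambda>t c. snd s ''rows'' (int (t * n + c)))"
  define lab' where "lab' = (\<lambda>t c. snd s' ''rows'' (int (t * n + c)))"
  define h where "h c = relabel (L i) (L j) (L c)" for c
  from inv obtain e where env: "env M n k s" and p: "stores n s ''p'' p"
    and e: "emitted M n (10 * (k + 2)) e s"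
    and refine: "\<And>u v. u < n \<Longrightarrow> v < n \<Longrightarrow> L u = L v \<Longrightarrow> twins M n p u v"
    and card: "\<And>a. card (L ` fiber n p a) \<le> g a"
    by (auto simp: invariant_def L_def)
  have t: "fst s ''t'' = int e" and base: "fst s ''base'' = int (e * n)"
    and cols: "\<And>t c. t \<le> e \<Longrightarrow> c < n \<Longrightarrow> snd s ''cols'' (int (t * n + c)) = lab t c"
    and L_lab: "\<And>c. c < n \<Longrightarrow> L c = lab e c" and trace: "merge_trace n lab e"
    and stretch: "\<And>t. t \<le> e \<Longrightarrow> stretch_value M (partition_of_labels n (lab t), partition_of_labels n (lab t))
      \<le> 10 * (k + 2)"
    using e unfolding emitted_def stores_def L_def lab_def Let_def by blast+
  have n: "fst s ''n'' = int n" using env by (simp add: env_def)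
  define s0 where "s0 = set_var ''t'' (int (Suc e)) (set_var ''base'' (int (Suc e * n))
      (set_var ''y'' (L j) (set_var ''x'' (L i) s)))"
  have s'_emit: "s' = run emit s0"
    by (simp add: s'_def merge_labels_def s0_def L_def i j n base t add.commute)
  have s0: "fst s0 ''n'' = int n" "fst s0 ''x'' = L i" "fst s0 ''y'' = L j"
    "fst s0 ''base'' = int (Suc e * n)" "snd s0 = snd s"
    by (simp_all add: s0_def n del: of_nat_mult mult_Suc)
  note emit = run_emit[OF s0(1-4), folded s'_emit, unfolded s0(5), folded L_def]
  have L': "snd s' ''L'' (int c) = h c" if "c < n" for c using emit(1)[OF that] by (simp add: h_def)
  then show "snd s' ''L'' (int c) =
      relabel (snd s ''L'' (int i)) (snd s ''L'' (int j)) (snd s ''L'' (int c))" if "c < n" for c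
    using that by (simp add: h_def L_def)
  \<comment> \<open>Partition t occupies the block of n cells starting at \<open>t * n\<close>, and
    \<open>emit\<close> writes to \<open>rows\<close> and \<open>cols\<close> only in the block of
    \<open>Suc e\<close>.\<close>
  have old: "snd s' A (int (t * n + c)) = snd s A (int (t * n + c))"
    if "A \<in> {''rows'', ''cols''}" "t \<le> e" "c < n" for A t c
  proof -
    have "t * n + c < Suc t * n" using that(3) by simp
    also have "\<dots> \<le> Suc e * n" using that(2) by (intro mult_le_mono1) simp
    finally have "\<not> Suc e * n \<le> t * n + c" by simp
    then show ?thesis using emit(2)[OF that(1), of "t * n + c"] by (simp only: simp_thms if_False)
  qed
  have new: "snd s' A (int (Suc e * n + c)) = h c" if "A \<in> {''rows'', ''cols''}" "c < n" for A c
  proof -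
    have "Suc e * n \<le> Suc e * n + c \<and> Suc e * n + c < Suc e * n + n" "Suc e * n + c - Suc e * n = c"
      using that(2) by auto
    then show ?thesis using emit(2)[OF that(1), of "Suc e * n + c"]
      by (simp only: simp_thms if_True h_def)
  qed
  have lab'_old: "lab' t c = lab t c" if "t \<le> e" "c < n" for t c
    unfolding lab_def lab'_def by (rule old) (use that in simp_all)
  have lab'_new: "lab' (Suc e) c = h c" if "c < n" for c
    unfolding lab'_def by (rule new) (use that in simp_all)
  \<comment> \<open>An index that carried the label of j is exchanged for its twin i. After this
    exchange equal new labels come from equal old ones, to which \<open>refine\<close>
    applies.\<close>
  have h_twins: "twins M n p u v" if uv: "u < n" "v < n" "h u = h v" for u v
  proof -
    have "twins M n p u (if L u = L j then i else u)" "twins M n p v (if L v = L j then i else v)"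
      using refine[of u j] refine[of v j] twins_trans[of M n p u j i] twins_trans[of M n p v j i]
        twins_sym[OF ij(1)] uv j by auto
    moreover have "L (if L u = L j then i else u) = L (if L v = L j then i else v)"
      using uv(3) by (auto simp: h_def relabel_def)
    then have "twins M n p (if L u = L j then i else u) (if L v = L j then i else v)"
      using refine uv i by auto
    ultimately show ?thesis by (meson twins_trans twins_sym)
  qed
  \<comment> \<open>New labels are a function of old ones, so no interval gains labels.\<close>
  have h_card: "card (h ` fiber n p a) \<le> g a" for a
  proof -
    have "h ` fiber n p a = relabel (L i) (L j) ` L ` fiber n p a"
      unfolding image_image h_def ..
    then have "card (h ` fiber n p a) \<le> card (L ` fiber n p a)"
      by (simp add: card_image_le)
    with card show ?thesis using order_trans by blast
  qed
  have "stretch_value M (partition_of_labels n h, partition_of_labels n h) \<le> 5 * (2 * (k + 2))"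
    by (rule stretch_value_labels_le[OF sym div])
      (use h_twins i order_trans[OF h_card g] in auto)
  moreover have "partition_of_labels n (lab' (Suc e)) = partition_of_labels n h"
    by (rule partition_of_labels_cong) (rule lab'_new)
  moreover have "partition_of_labels n (lab' t) = partition_of_labels n (lab t)" if "t \<le> e" for t
    by (rule partition_of_labels_cong) (use lab'_old that in auto)
  ultimately have stretch': "stretch_value M (partition_of_labels n (lab' t), partition_of_labels n (lab' t))
      \<le> 10 * (k + 2)" if "t \<le> Suc e" for t
    using that stretch by (cases "t = Suc e") auto
  have "merge_trace n lab' (Suc e)"
  proof (rule merge_trace_Suc[OF trace i(2) j(2)])
    show "lab e i \<noteq> lab e j" using ij(2) L_lab i j by (simp add: L_def)
    show "lab' (Suc e) c = relabel (lab e i) (lab e j) (lab e c)" if "c < n" for c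
      using lab'_new that L_lab i j by (simp add: h_def)
  qed (rule lab'_old)
  moreover have "snd s' ''cols'' (int (t * n + c)) = lab' t c" if "t \<le> Suc e" "c < n" for t c
  proof (cases "t = Suc e")
    case True
    show ?thesis unfolding True lab'_new[OF that(2)] by (rule new) (use that in simp_all)
  next
    case False
    then have "t \<le> e" using that by simp
    from old[OF _ this that(2), of "''cols''"] cols[OF this that(2)] lab'_old[OF this that(2)]
    show ?thesis by (simp only: insert_iff simp_thms)
  qed
  moreover have "fst s' ''t'' = int (Suc e)" "fst s' ''base'' = int (Suc e * n)"
    by (simp_all add: s'_emit s0_def)
  moreover have "snd s' ''L'' (int c) = lab' (Suc e) c" if "c < n" for c
    using L'[OF that] lab'_new[OF that] by metis
  ultimately have "emitted M n (10 * (k + 2)) (Suc e) s'"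
    using stretch' unfolding emitted_def stores_def lab'_def Let_def by blast
  moreover have "env M n k s'"
    by (rule env_cong[OF env]) (auto simp: s'_def)
  moreover have "stores n s' ''p'' p" using p by (simp add: s'_def stores_def)
  moreover have "(\<lambda>c. snd s' ''L'' (int c)) ` fiber n p a = h ` fiber n p a" for a
    by (rule image_cong[OF refl]) (simp add: L' fiber_def)
  ultimately show "invariant M n k p g s'"
    using h_twins h_card L' unfolding invariant_def by auto
qed

text \<open>\<open>S\<close> is the set of pairs visited so far. On all pairs this is the converse
  of the twin clause of \<open>invariant\<close>, and the parts are then exactly the twin
  classes.\<close>

definition closed_on :: "int mat \<Rightarrow> nat \<Rightarrow> (nat \<Rightarrow> int) \<Rightarrow> (nat \<times> nat) set \<Rightarrow> state \<Rightarrow> bool" where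
  "closed_on M n p S s \<longleftrightarrow>
     (\<forall>(u, v)\<in>S. twins M n p u v \<longrightarrow> snd s ''L'' (int u) = snd s ''L'' (int v))"

lemma run_merge_if_twins:
  assumes sym: "\<forall>i<n. \<forall>j<n. M $$ (i, j) = M $$ (j, i)"
    and div: "division n p" and inv: "invariant M n k p g s" and g: "\<And>a. g a \<le> 2 * (k + 2)"
    and i: "fst s ''i'' = int i" "i < n" and j: "fst s ''j'' = int j" "j < n"
    and closed: "closed_on M n p S s" and S: "S \<subseteq> {..<n} \<times> {..<n}"
  defines "s' \<equiv> run merge_if_twins s"
  shows "invariant M n k p g s'" and "closed_on M n p (insert (i, j) S) s'"
proof -
  define s1 where "s1 = run (differences ''p'') s"
  have env: "env M n k s" and p: "stores n s ''p'' p" using inv by (auto simp: invariant_def)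
  have d: "fst s1 ''d'' \<le> 0 \<longleftrightarrow> (\<forall>c<n. near p i c \<or> M $$ (i, c) = M $$ (j, c))"
    unfolding s1_def by (rule run_differences[OF env p i j])
  have s1: "snd s1 = snd s" "fst s1 ''i'' = int i" "fst s1 ''j'' = int j"
    using i j by (simp_all add: s1_def snd_run_no_arrays)
  have inv1: "invariant M n k p g s1"
    by (rule invariant_cong[OF inv]) (auto simp: s1_def)
  define L where "L c = snd s ''L'' (int c)" for c
  have cond: "bval (Conj (equal (Read ''p'' (Var ''i'')) (Read ''p'' (Var ''j'')))
      (Conj (Leq (Var ''d'') (Lit 0)) (Neg (equal (Read ''L'' (Var ''i'')) (Read ''L'' (Var ''j''))))))
      s1 \<longleftrightarrow> twins M n p i j \<and> L i \<noteq> L j"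
    using p i j by (simp add: s1 d twins_def stores_def L_def)
  have s': "s' = (if twins M n p i j \<and> L i \<noteq> L j then run merge_labels s1 else s1)"
    unfolding s'_def merge_if_twins_def run.simps s1_def[symmetric] cond ..
  have "invariant M n k p g s' \<and> closed_on M n p (insert (i, j) S) s'"
  proof (cases "twins M n p i j \<and> L i \<noteq> L j")
    case True
    have ne: "snd s1 ''L'' (int i) \<noteq> snd s1 ''L'' (int j)" using True by (simp add: s1 L_def)
    note merge = run_merge_labels[OF sym div inv1 g s1(2) i(2) s1(3) j(2) conjunct1[OF True] ne]
    have s'_eq: "s' = run merge_labels s1" using s' True by simp
    have L': "snd s' ''L'' (int c) = relabel (L i) (L j) (L c)" if "c < n" for c
      using merge(2)[OF that] by (simp add: s'_eq s1 L_def)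
    have "closed_on M n p (insert (i, j) S) s'"
      unfolding closed_on_def
    proof (intro ballI, clarify)
      fix u v assume uv: "(u, v) \<in> insert (i, j) S" "twins M n p u v"
      have n: "u < n" "v < n" using uv(1) S i j by auto
      \<comment> \<open>Relabelling preserves equality of labels, so pairs closed earlier stay
        closed; hence one pass over all pairs suffices.\<close>
      have "(u = i \<and> v = j) \<or> L u = L v" using uv closed by (auto simp: closed_on_def L_def)
      then show "snd s' ''L'' (int u) = snd s' ''L'' (int v)"
        by (auto simp: L'[OF n(1)] L'[OF n(2)] relabel_def)
    qed
    then show ?thesis using merge(1) by (simp add: s'_eq)
  next
    case False
    then have "s' = s1" using s' by auto
    then show ?thesis using inv1 closed False by (auto simp: closed_on_def s1 L_def)
  qed
  then show "invariant M n k p g s'" and "closed_on M n p (insert (i, j) S) s'" by blast+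
qed

lemma run_close:
  assumes sym: "\<forall>i<n. \<forall>j<n. M $$ (i, j) = M $$ (j, i)"
    and div: "division n p" and inv: "invariant M n k p g s" and g: "\<And>a. g a \<le> 2 * (k + 2)"
  shows "invariant M n k p g (run close s)" and "closed_on M n p ({..<n} \<times> {..<n}) (run close s)"
proof -
  have set_var_inv: "invariant M n k p g (set_var x v s')"
    if "invariant M n k p g s'" "x \<notin> {''n'', ''k'', ''t'', ''base''}" for x v s'
    using that(2) by (intro invariant_cong[OF that(1)]) auto
  have set_var_closed: "closed_on M n p S (set_var x v s') = closed_on M n p S s'" for S x v s'
    by (simp add: closed_on_def)
  let ?S = "\<lambda>i j. {..<i} \<times> {..<n} \<union> {i} \<times> {..<j}"
  let ?I = "\<lambda>i s'. invariant M n k p g s' \<and> closed_on M n p ({..<i} \<times> {..<n}) s'"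
  let ?J = "\<lambda>i j s'. invariant M n k p g s' \<and> fst s' ''i'' = int i \<and> closed_on M n p (?S i j) s'"
  have n: "fst s ''n'' = int n" using inv by (simp add: invariant_def env_def)
  obtain s' where "?I n s'" "run close s = set_var ''i'' (int n) s'"
    unfolding close_def
  proof (rule run_For_invariant[where I = ?I, OF n])
    show "?I 0 s" using inv by (simp add: closed_on_def)
    fix i s1 assume i: "i < n" and I: "?I i s1"
    let ?s = "set_var ''i'' (int i) s1"
    have n1: "fst ?s ''n'' = int n" using I by (simp add: invariant_def env_def)
    obtain s2 where J: "?J i n s2" and s2: "run (For ''j'' merge_if_twins) ?s = set_var ''j'' (int n) s2"
    proof (rule run_For_invariant[where I = "?J i", OF n1])
      show "?J i 0 ?s" using I set_var_inv by (simp add: set_var_closed)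
      fix j s3 assume j: "j < n" and J: "?J i j s3"
      let ?t = "set_var ''j'' (int j) s3"
      have inv3: "invariant M n k p g ?t" using J by (intro set_var_inv) auto
      have ij: "fst ?t ''i'' = int i" "fst ?t ''j'' = int j" using J by simp_all
      have cl: "closed_on M n p (?S i j) ?t" using J by (simp add: set_var_closed)
      have sub: "?S i j \<subseteq> {..<n} \<times> {..<n}" using i j by auto
      note step = run_merge_if_twins[OF sym div inv3 g ij(1) i ij(2) j cl sub]
      have "insert (i, j) (?S i j) = ?S i (Suc j)" by auto
      then show "?J i (Suc j) (run merge_if_twins ?t)"
        using step J by simp
    qed
    have "?S i n = {..<Suc i} \<times> {..<n}" by auto
    then show "?I (Suc i) (run (For ''j'' merge_if_twins) ?s)"
      using J set_var_inv unfolding s2 by (simp add: set_var_closed)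
  qed
  then show "invariant M n k p g (run close s)" and "closed_on M n p ({..<n} \<times> {..<n}) (run close s)"
    using set_var_inv by (simp_all add: set_var_closed)
qed

section \<open>One greedy step\<close>

definition stable :: "int mat \<Rightarrow> nat \<Rightarrow> nat \<Rightarrow> (nat \<Rightarrow> int) \<Rightarrow> state \<Rightarrow> bool" where
  "stable M n k p s \<longleftrightarrow> division n p \<and> invariant M n k p (\<lambda>_. k + 2) s \<and>
     closed_on M n p ({..<n} \<times> {..<n}) s"

lemma stable_set_var:
  assumes "stable M n k p s" and "x \<notin> {''n'', ''k'', ''t'', ''base''}"
  shows "stable M n k p (set_var x v s)"
proof -
  have "invariant M n k p (\<lambda>_. k + 2) (set_var x v s)"
    by (rule invariant_cong) (use assms in \<open>auto simp: stable_def\<close>)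
  moreover have "closed_on M n p S (set_var x v s) = closed_on M n p S s" for S
    by (simp add: closed_on_def)
  ultimately show ?thesis using assms(1) by (simp add: stable_def)
qed

text \<open>Take the least twin of i; by transitivity it has no earlier twin itself.\<close>

lemma exists_leader:
  assumes "i \<in> fiber n p a"
  shows "\<exists>l\<in>leaders M n p a. twins M n p l i"
proof -
  define l where "l = (LEAST j. twins M n p j i)"
  have l: "twins M n p l i" unfolding l_def by (rule LeastI[of _ i]) simp
  have "l \<le> i" unfolding l_def by (rule Least_le) simp
  moreover have "\<not> twins M n p j l" if "j < l" for j
    using twins_trans[OF _ l] not_less_Least[OF that[unfolded l_def]] by blast
  moreover have "p l = p i" using l by (simp add: twins_def)
  ultimately have "l \<in> leaders M n p a" using assms by (auto simp: leaders_def fiber_def)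
  with l show ?thesis by blast
qed

text \<open>Between merging and closing, interval \<open>a\<close> holds the parts of two former
  intervals with at most k + 2 each.\<close>

definition fiber_bound :: "nat \<Rightarrow> int \<Rightarrow> int \<Rightarrow> nat" where
  "fiber_bound k a b = (if b = a then 2 * (k + 2) else k + 2)"

lemma invariant_merge_fibers:
  assumes inv: "invariant M n k p (\<lambda>_. k + 2) s" and stores: "stores n s' ''p'' (merge_fibers a p)"
    and frame: "\<And>x. x \<in> {''n'', ''k'', ''t'', ''base''} \<Longrightarrow> fst s' x = fst s x"
      "\<And>x. x \<in> {''mul'', ''M'', ''L'', ''rows'', ''cols''} \<Longrightarrow> snd s' x = snd s x"
  shows "invariant M n k (merge_fibers a p) (fiber_bound k a) s'"
proof -
  let ?p = "merge_fibers a p" and ?L = "\<lambda>c. snd s ''L'' (int c)"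
  have L: "snd s' ''L'' = snd s ''L''" by (rule frame) simp
  have env: "env M n k s" and card: "\<And>b. card (?L ` fiber n p b) \<le> k + 2"
    using inv by (simp_all add: invariant_def)
  have bound: "card (?L ` fiber n ?p b) \<le> fiber_bound k a b" for b
  proof -
    consider "b < a" | "b = a" | "b > a" by linarith
    then show ?thesis
    proof cases
      case 1
      then have "fiber n ?p b = fiber n p b" by (auto simp: fiber_def merge_fibers_def)
      then show ?thesis using card[of b] 1 by (simp add: fiber_bound_def)
    next
      case 2
      have "fiber n ?p a = fiber n p a \<union> fiber n p (a + 1)" by (auto simp: fiber_def merge_fibers_def)
      then have "card (?L ` fiber n ?p a) \<le> card (?L ` fiber n p a) + card (?L ` fiber n p (a + 1))"
        by (simp add: image_Un card_Un_le)
      then show ?thesis using card[of a] card[of "a + 1"] 2 by (simp add: fiber_bound_def)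
    next
      case 3
      then have "fiber n ?p b = fiber n p (b + 1)" by (auto simp: fiber_def merge_fibers_def)
      then show ?thesis using card[of "b + 1"] 3 by (simp add: fiber_bound_def)
    qed
  qed
  have "env M n k s'" by (rule env_cong[OF env]) (use frame in auto)
  moreover have "emitted M n b e s' = emitted M n b e s" for b e
    using frame by (simp add: emitted_def stores_def)
  ultimately show ?thesis
    using inv stores bound twins_merge_fibers by (auto simp: invariant_def L)
qed

text \<open>After closing, each label in the merged interval is the label of a leader, so the
  accepted class count bounds the labels. The windows of other intervals may have grown too, but
  closing there cannot raise their counts.\<close>

lemma run_step:
  assumes sym: "\<forall>i<n. \<forall>j<n. M $$ (i, j) = M $$ (j, i)"
    and stable: "stable M n k p s" and a: "fst s ''a'' = a" "0 \<le> a"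
  shows "stable M n k
    (if card (leaders M n (merge_fibers a p) a) \<le> k + 2 then merge_fibers a p else p)
    (run (LSeq try_merge close) s)"
proof -
  define s1 where "s1 = run try_merge s"
  have div: "division n p" and inv: "invariant M n k p (\<lambda>_. k + 2) s"
    using stable by (auto simp: stable_def)
  then have env: "env M n k s" and p: "stores n s ''p'' p" by (auto simp: invariant_def)
  have p1: "stores n s1 ''p''
    (if card (leaders M n (merge_fibers a p) a) \<le> k + 2 then merge_fibers a p else p)"
    unfolding s1_def by (rule run_try_merge[OF env p a(1)])
  have frame: "fst s1 x = fst s x" if "x \<in> {''n'', ''k'', ''t'', ''base''}" for x
    using that by (auto simp: s1_def)
  have frame': "snd s1 x = snd s x" if "x \<in> {''mul'', ''M'', ''L'', ''rows'', ''cols''}" for x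
    using that by (auto simp: s1_def)
  show ?thesis
  proof (cases "card (leaders M n (merge_fibers a p) a) \<le> k + 2")
    case True
    let ?p = "merge_fibers a p"
    have div1: "division n ?p" using div a(2) by (rule division_merge_fibers)
    have p1': "stores n s1 ''p'' ?p" using p1 True by simp
    have inv1: "invariant M n k ?p (fiber_bound k a) s1"
      by (rule invariant_merge_fibers[OF inv p1' frame frame'])
    have "fiber_bound k a b \<le> 2 * (k + 2)" for b by (simp add: fiber_bound_def)
    note close = run_close[OF sym div1 inv1 this]
    let ?L = "\<lambda>c. snd (run close s1) ''L'' (int c)"
    have "?L ` fiber n ?p a \<subseteq> ?L ` leaders M n ?p a"
    proof (rule image_subsetI)
      fix i assume i: "i \<in> fiber n ?p a"
      then obtain l where "l \<in> leaders M n ?p a" "twins M n ?p l i" using exists_leader by blast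
      moreover from this i have "?L l = ?L i"
        using close(2) by (auto simp: closed_on_def leaders_def fiber_def)
      ultimately show "?L i \<in> ?L ` leaders M n ?p a" by (metis imageI)
    qed
    moreover have fin: "finite (leaders M n ?p a)" by (simp add: leaders_def)
    ultimately have "card (?L ` fiber n ?p a) \<le> card (?L ` leaders M n ?p a)"
      by (intro card_mono) auto
    also have "\<dots> \<le> k + 2" using card_image_le[OF fin] True by (rule order_trans)
    finally have at_a: "card (?L ` fiber n ?p a) \<le> k + 2" .
    have "card (?L ` fiber n ?p b) \<le> k + 2" for b
    proof (cases "b = a")
      case False
      have "card (?L ` fiber n ?p b) \<le> fiber_bound k a b" using close(1) by (simp add: invariant_def)
      then show ?thesis using False by (simp add: fiber_bound_def)
    qed (use at_a in simp)
    then have "invariant M n k ?p (\<lambda>_. k + 2) (run close s1)"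
      using close(1) by (simp add: invariant_def)
    then show ?thesis using div1 close(2) True by (simp add: stable_def s1_def)
  next
    case False
    have "invariant M n k p (\<lambda>_. k + 2) s1"
    proof -
      have "emitted M n b e s1 = emitted M n b e s" for b e
        using frame frame' by (simp add: emitted_def stores_def)
      moreover have "env M n k s1" by (rule env_cong[OF env]) (use frame frame' in auto)
      ultimately show ?thesis using inv p1 False frame' by (simp add: invariant_def)
    qed
    from run_close[OF sym div this] show ?thesis using div False by (simp add: stable_def s1_def)
  qed
qed

section \<open>The main loop and its initial state\<close>

definition stuck :: "int mat \<Rightarrow> nat \<Rightarrow> nat \<Rightarrow> (nat \<Rightarrow> int) \<Rightarrow> bool" where
  "stuck M n k p \<longleftrightarrow>
     (\<forall>a. 0 \<le> a \<longrightarrow> a < p (n - 1) \<longrightarrow> k + 2 < card (leaders M n (merge_fibers a p) a))"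

lemma run_main_loop:
  assumes sym: "\<forall>i<n. \<forall>j<n. M $$ (i, j) = M $$ (j, i)" and n: "1 \<le> n"
    and stable: "stable M n k p s"
  shows "\<exists>p. stable M n k p (run main_loop s) \<and> stuck M n k p"
proof -
  let ?I = "\<lambda>u s'. \<exists>p. stable M n k p s' \<and> (p (n - 1) + int u \<le> int (n - 1) \<or> stuck M n k p)"
  \<comment> \<open>Each round has to lower the bound on the last interval number by one, unless
    \<open>p\<close> is stuck. Within round u, either this has happened, or \<open>p\<close> is
    stuck, or every number tried so far was rejected for the current \<open>p\<close>; a rejected
    attempt leaves \<open>p\<close> alone, so earlier rejections stay valid.\<close>
  let ?J = "\<lambda>u a s'. \<exists>p. stable M n k p s' \<and> (p (n - 1) + int (Suc u) \<le> int (n - 1) \<or> stuck M n k p \<or>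
    p (n - 1) + int u \<le> int (n - 1) \<and>
    (\<forall>a'. 0 \<le> a' \<longrightarrow> a' < int a \<longrightarrow> a' < p (n - 1) \<longrightarrow> k + 2 < card (leaders M n (merge_fibers a' p) a')))"
  have n_s: "fst s' ''n'' = int n" if "stable M n k p s'" for p s'
    using that by (simp add: stable_def invariant_def env_def)
  have step: "p i \<le> int i" if "division n p" "i < n" for p i
    using that(2)
  proof (induction i)
    case 0
    then show ?case using that(1) by (simp add: division_def)
  next
    case (Suc i)
    have "p (Suc i) \<le> p i + 1" using that(1) Suc.prems by (simp add: division_def)
    then show ?case using Suc by simp
  qed
  obtain s' where I: "?I n s'" and s': "run main_loop s = set_var ''u'' (int n) s'"
    unfolding main_loop_def
  proof (rule run_For_invariant[where I = ?I, OF n_s[OF stable]])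
    have "p (n - 1) \<le> int (n - 1)"
      by (rule step) (use stable n in \<open>auto simp: stable_def\<close>)
    then show "?I 0 s" using stable by auto
    fix u s1 assume u: "u < n" and I: "?I u s1"
    let ?s = "set_var ''u'' (int u) s1"
    from I obtain p1 where p1: "stable M n k p1 ?s" "p1 (n - 1) + int u \<le> int (n - 1) \<or> stuck M n k p1"
      using stable_set_var[of M n k _ s1 "''u''"] by auto
    obtain s2 where J: "?J u n s2"
      and s2: "run (For ''a'' (LSeq try_merge close)) ?s = set_var ''a'' (int n) s2"
    proof (rule run_For_invariant[where I = "?J u", OF n_s[OF p1(1)]])
      show "?J u 0 ?s" using p1 by auto
      fix a s3 assume a: "a < n" and J: "?J u a s3"
      let ?t = "set_var ''a'' (int a) s3"
      from J obtain p where p: "stable M n k p ?t" and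
        cases: "p (n - 1) + int (Suc u) \<le> int (n - 1) \<or> stuck M n k p \<or>
          p (n - 1) + int u \<le> int (n - 1) \<and>
          (\<forall>a'. 0 \<le> a' \<longrightarrow> a' < int a \<longrightarrow> a' < p (n - 1) \<longrightarrow> k + 2 < card (leaders M n (merge_fibers a' p) a'))"
        using stable_set_var[of M n k _ s3 "''a''"] by auto
      let ?p = "merge_fibers (int a) p"
      define ok where "ok \<longleftrightarrow> card (leaders M n ?p (int a)) \<le> k + 2"
      define p' where "p' = (if ok then ?p else p)"
      have stable': "stable M n k p' (run (LSeq try_merge close) ?t)"
        unfolding p'_def ok_def by (rule run_step[OF sym p]) simp_all
      have div: "division n p" using p by (simp add: stable_def)
      \<comment> \<open>An attempt at or beyond the last interval changes nothing, whatever its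
        class count is.\<close>
      consider "p' = p" "\<not> ok \<or> p (n - 1) \<le> int a" | "ok" "int a < p (n - 1)" "p' (n - 1) = p (n - 1) - 1"
        using merge_fibers_trivial[OF div, of "int a"]
        by (cases "p (n - 1) \<le> int a") (auto simp: p'_def merge_fibers_def)
      then show "?J u (Suc a) (run (LSeq try_merge close) ?t)"
      proof cases
        case 1
        have new: "k + 2 < card (leaders M n (merge_fibers (int a) p) (int a))" if "int a < p (n - 1)"
          using 1(2) that by (auto simp: ok_def)
        have "a' < int a \<or> a' = int a" if "a' < int (Suc a)" for a' using that by linarith
        then have "p (n - 1) + int (Suc u) \<le> int (n - 1) \<or> stuck M n k p \<or>
          p (n - 1) + int u \<le> int (n - 1) \<and>
          (\<forall>a'. 0 \<le> a' \<longrightarrow> a' < int (Suc a) \<longrightarrow> a' < p (n - 1) \<longrightarrow> k + 2 < card (leaders M n (merge_fibers a' p) a'))"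
          using cases new by blast
        then show ?thesis using stable' 1(1) by blast
      next
        case 2
        have "\<not> stuck M n k p" 
          using 2(1,2) unfolding stuck_def ok_def by (metis not_le of_nat_0_le_iff)
        then have "p' (n - 1) + int (Suc u) \<le> int (n - 1)" using cases 2(3) by auto
        then show ?thesis using stable' by blast
      qed
    qed
    from J obtain p where p: "stable M n k p s2" and
      cases: "p (n - 1) + int (Suc u) \<le> int (n - 1) \<or> stuck M n k p \<or>
        (\<forall>a'. 0 \<le> a' \<longrightarrow> a' < int n \<longrightarrow> a' < p (n - 1) \<longrightarrow> k + 2 < card (leaders M n (merge_fibers a' p) a'))"
      by blast
    have "p (n - 1) \<le> int (n - 1)"
      by (rule step) (use p n in \<open>auto simp: stable_def\<close>)
    then have "a' < int n" if "a' < p (n - 1)" for a' using that n by linarith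
    then have "p (n - 1) + int (Suc u) \<le> int (n - 1) \<or> stuck M n k p"
      using cases unfolding stuck_def by blast
    moreover have "stable M n k p (set_var ''a'' (int n) s2)"
      using p by (rule stable_set_var) simp
    ultimately show "?I (Suc u) (run (For ''a'' (LSeq try_merge close)) ?s)"
      unfolding s2 by blast
  qed
  from I obtain p where p: "stable M n k p s'" and *: "p (n - 1) + int n \<le> int (n - 1) \<or> stuck M n k p"
    by blast
  \<comment> \<open>After n rounds the alternative to \<open>stuck\<close> would make the last
    interval number negative.\<close>
  have "0 \<le> p (n - 1)" by (rule division_bounds) (use p n in \<open>auto simp: stable_def\<close>)
  with * n have "stuck M n k p" by auto
  moreover have "stable M n k p (run main_loop s)"
    unfolding s' using p by (rule stable_set_var) simp
  ultimately show ?thesis by blast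
qed

text \<open>Initially every index is an interval of its own, so distinct indices are never twins and
  nothing has to be closed.\<close>

lemma run_initialize:
  assumes sym: "\<forall>i<n. \<forall>j<n. M $$ (i, j) = M $$ (j, i)" and n: "1 \<le> n"
  shows "\<exists>p. stable M n k p (run initialize (input_state n (int k) M))"
proof -
  define p where "p i = (if i < n then int i else 0)" for i
  let ?s = "input_state n (int k) M"
  let ?I = "\<lambda>i s. fst s ''n'' = int n \<and> fst s ''k'' = int k \<and> fst s ''t'' = 0 \<and> fst s ''base'' = 0 \<and>
    fst s ''z'' = int (i * n) \<and> snd s ''M'' = snd ?s ''M'' \<and>
    (\<forall>j<i. snd s ''mul'' (int j) = int (j * n)) \<and>
    (\<forall>x\<in>{''p'', ''L'', ''rows'', ''cols''}. \<forall>j<i. snd s x (int j) = int j)"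
  have n_s: "fst ?s ''n'' = int n" by (simp add: input_state_def)
  obtain s' where I: "?I n s'" and s': "run initialize ?s = set_var ''i'' (int n) s'"
    unfolding initialize_def
    by (rule run_For_invariant[where I = ?I, OF n_s])
      (auto simp: input_state_def less_Suc_eq algebra_simps)
  define s1 where "s1 = run initialize ?s"
  have s1: "fst s1 ''n'' = int n" "fst s1 ''k'' = int k" "fst s1 ''t'' = 0" "fst s1 ''base'' = 0"
    "snd s1 ''M'' = snd ?s ''M''" "\<And>j. j < n \<Longrightarrow> snd s1 ''mul'' (int j) = int (j * n)"
    "\<And>x j. x \<in> {''p'', ''L'', ''rows'', ''cols''} \<Longrightarrow> j < n \<Longrightarrow> snd s1 x (int j) = int j"
    using I unfolding s1_def s' by auto
  have M: "snd s1 ''M'' (int (i * n + j)) = M $$ (i, j)" if "i < n" "j < n" for i j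
  proof -
    have "i * n + j < Suc i * n" using that(2) by simp
    also have "\<dots> \<le> n * n" using that(1) by (intro mult_le_mono1) simp
    finally have "int (i * n + j) < int (n * n)" by (simp only: of_nat_less_iff)
    moreover have "(i * n + j) div n = i" "(i * n + j) mod n = j" using that by auto
    ultimately show ?thesis unfolding s1(5) by (simp add: input_state_def del: of_nat_add of_nat_mult)
  qed
  have env: "env M n k s1" using s1 M by (simp add: env_def stores_def)
  have div: "division n p" by (auto simp: division_def p_def)
  have inj: "i = j" if "p i = p j" "i < n" "j < n" for i j using that by (simp add: p_def)
  let ?lab = "\<lambda>t c. snd s1 ''rows'' (int (t * n + c))"
  have lab: "?lab 0 c = int c" if "c < n" for c using s1(7) that by simp
  have card: "card (f ` fiber n p a) \<le> 1" for f :: "nat \<Rightarrow> int" and a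
  proof -
    have "fiber n p a \<subseteq> {nat a}" by (auto simp: fiber_def p_def)
    then have "card (fiber n p a) \<le> 1" using card_mono[of "{nat a}"] by fastforce
    then show ?thesis using card_image_le[OF finite_fiber, of f n p a] by linarith
  qed
  have "stretch_value M (partition_of_labels n (?lab 0), partition_of_labels n (?lab 0)) \<le> 5 * 1"
    by (rule stretch_value_labels_le[OF sym div n _ card]) (use lab in auto)
  moreover have "merge_trace n ?lab 0"
    by (rule merge_trace_0) (use lab in \<open>auto simp: inj_on_def\<close>)
  ultimately have "emitted M n (10 * (k + 2)) 0 s1"
    using s1 lab by (simp add: emitted_def stores_def Let_def del: stretch_value.simps)
  then have "invariant M n k p (\<lambda>_. k + 2) s1"
    using env s1(7) card by (auto simp: invariant_def stores_def p_def intro: order_trans[OF card])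
  moreover have "closed_on M n p ({..<n} \<times> {..<n}) s1"
    using inj by (auto simp: closed_on_def twins_def)
  ultimately show ?thesis using div unfolding s1_def by (auto simp: stable_def)
qed

section \<open>The final state and the answer\<close>

lemma stable_single_interval:
  assumes stable: "stable M n k p s" and zero: "p (n - 1) = 0" and e: "emitted M n b e s" and n: "1 \<le> n"
  shows "Suc e = n"
proof -
  let ?lab = "\<lambda>c. snd s ''rows'' (int (e * n + c))"
  have div: "division n p" and closed: "closed_on M n p ({..<n} \<times> {..<n}) s"
    using stable by (auto simp: stable_def)
  have p0: "p i = 0" if "i < n" for i using division_bounds[OF div that] zero by simp
  \<comment> \<open>With one interval the window contains every column, so all indices are twins and
    closing has left a single label. The count in \<open>merge_trace\<close> then determines
    \<open>e\<close>.\<close>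
  have "snd s ''L'' (int i) = snd s ''L'' (int 0)" if "i < n" for i
  proof -
    have "twins M n p i 0" using p0 that n by (auto simp: twins_def near_def)
    moreover have "(i, 0) \<in> {..<n} \<times> {..<n}" using that n by simp
    ultimately show ?thesis using closed unfolding closed_on_def by blast
  qed
  moreover have "snd s ''L'' (int i) = ?lab i" if "i < n" for i
    using e that unfolding emitted_def stores_def by blast
  moreover have "0 < n" using n by simp
  ultimately have eq: "?lab i = ?lab 0" if "i < n" for i
    using that by metis
  have "?lab ` {..<n} = (\<lambda>_. ?lab 0) ` {..<n}"
    by (rule image_cong[OF refl], rule eq) simp
  also have "\<dots> = {?lab 0}" by (rule image_constant[of 0]) (use n in simp)
  finally have "?lab ` {..<n} = {?lab 0}" .
  then have "card (partition_of_labels n ?lab) = 1" 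
    by (simp add: card_partition_of_labels)
  then show ?thesis using e by (simp add: emitted_def merge_trace_def)
qed

lemma sequence_of_emitted:
  assumes e: "emitted M n b (n - 1) s" and n: "1 \<le> n"
  shows "symmetric_partition_sequence n (output_sequence n s)"
    and "P \<in> set (output_sequence n s) \<Longrightarrow> stretch_value M P \<le> b"
proof -
  let ?lab = "\<lambda>t c. snd s ''rows'' (int (t * n + c))"
  have cols: "partition_of_labels n (\<lambda>c. snd s ''cols'' (int (t * n + c))) = partition_of_labels n (?lab t)"
    if "t < n" for t
    by (rule partition_of_labels_cong) (use e that in \<open>auto simp: emitted_def\<close>)
  have out: "output_sequence n s = map (\<lambda>t. (partition_of_labels n (?lab t), partition_of_labels n (?lab t))) [0..<n]"
    unfolding output_sequence_def by (rule map_cong[OF refl]) (use cols in auto)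
  have "merge_trace n ?lab (n - 1)" using e unfolding emitted_def by blast
  then show "symmetric_partition_sequence n (output_sequence n s)"
    unfolding out using n by (rule merge_trace_sequence)
  show "stretch_value M P \<le> b" if "P \<in> set (output_sequence n s)"
  proof -
    from that obtain t where "t < n" "P = (partition_of_labels n (?lab t), partition_of_labels n (?lab t))"
      unfolding out by auto
    moreover from this(1) have "t \<le> n - 1" by simp
    ultimately show ?thesis using e unfolding emitted_def Let_def by blast
  qed
qed

lemma run_program:
  fixes M :: "int mat" and k :: int
  assumes n: "1 \<le> n" and sym: "\<forall>i<n. \<forall>j<n. M $$ (i, j) = M $$ (j, i)" and dim: "dim_row M = n"
  defines "s \<equiv> run program (input_state n k M)"
  shows "(\<exists>Ps. outputs_sequence n s Ps \<and> symmetric_partition_sequence n Ps \<and>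
            (\<forall>P\<in>set Ps. int (stretch_value M P) \<le> 30 * k ^ 3)) \<or>
         (reports_large s \<and> int (stw M) > k)"
proof -
  define s1 where "s1 = run main_loop (run initialize (input_state n k M))"
  have s: "s = run report s1" by (simp add: s_def program_def s1_def)
  show ?thesis
  proof (cases "1 \<le> k")
    case False
    have "fst s1 ''k'' = k"
      by (simp add: s1_def main_loop_def input_state_def)
    then have "reports_large s" using False by (simp add: s report_def reports_large_def)
    moreover have "k < int (stw M)"
    proof (rule stw_greater[OF dim n])
      fix Ps assume seq: "symmetric_partition_sequence n Ps"
      have pos: "0 < n" using n by simp
      obtain Q where diag: "\<And>t. t < n \<Longrightarrow> Ps ! t = (Q t, Q t)"
        and part: "\<And>t. t < n \<Longrightarrow> partition_on {..<n} (Q t)" and "Q 0 = singletons n"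
        using sequence_diagonal[OF seq] by metis
      then have Q: "Ps ! 0 = (Q 0, Q 0)" "partition_on {..<n} (Q 0)" "Q 0 = singletons n"
        using diag[OF pos] part[OF pos] by blast+
      have "{0} \<in> Q 0" using n Q(3) by (auto simp: singletons_def)
      from row_stretch_pos[OF Q(2) this] row_stretch_le_stretch_value[OF Q(2) this]
      have "1 \<le> stretch_value M (Q 0, Q 0)" using order_trans by blast
      moreover have "Ps ! 0 \<in> set Ps"
        by (rule nth_mem) (use seq pos in \<open>simp add: symmetric_partition_sequence_def\<close>)
      ultimately show "\<exists>P\<in>set Ps. k < int (stretch_value M P)"
        using False Q(1) by (intro bexI[of _ "Ps ! 0"]) auto
    qed
    ultimately show ?thesis by blast
  next
    case True
    define m where "m = nat k"
    have k: "k = int m" "1 \<le> m" using True by (auto simp: m_def)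
    obtain p where p: "stable M n m p s1" "stuck M n m p"
      unfolding s1_def k(1) using run_initialize[OF sym n] run_main_loop[OF sym n] by blast
    then have env: "env M n m s1" by (simp add: stable_def invariant_def)
    from p(1) obtain e where e: "emitted M n (10 * (m + 2)) e s1" by (auto simp: stable_def invariant_def)
    have t: "fst s1 ''t'' = int e" using e by (simp add: emitted_def)
    have s_answer: "s = set_var ''answer'' (if n \<le> Suc e then 1 else 0) s1"
      using env t k by (auto simp: s report_def env_def)
    show ?thesis
    proof (cases "n \<le> Suc e")
      case True
      let ?P = "partition_of_labels n (\<lambda>c. snd s1 ''rows'' (int (e * n + c)))"
      \<comment> \<open>At least one part remains, so the count leaves room for at most n - 1
        merges.\<close>
      have "card ?P \<noteq> 0"
        unfolding card_partition_of_labels using n by (simp add: lessThan_empty_iff)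
      moreover have "card ?P + e = n"
        using e unfolding emitted_def merge_trace_def by blast
      ultimately have "e = n - 1" using True by linarith
      moreover have "emitted M n (10 * (m + 2)) e s"
        using e by (simp add: s_answer emitted_def stores_def)
      ultimately have em: "emitted M n (10 * (m + 2)) (n - 1) s" by simp
      \<comment> \<open>The linear bound is within the cubic one because m is at least 1, so that m
        + 2 is at most 3m.\<close>
      have "10 * (m + 2) \<le> 30 * m ^ 3"
      proof -
        have "m \<le> m ^ 3" using k(2) by (simp add: self_le_power)
        have "10 * (m + 2) \<le> 30 * m" using k(2) by simp
        also have "\<dots> \<le> 30 * m ^ 3" using \<open>m \<le> m ^ 3\<close> by (rule mult_le_mono2)
        finally show ?thesis .
      qed
      then have "int (stretch_value M P) \<le> 30 * k ^ 3" if "P \<in> set (output_sequence n s)" for P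
        using sequence_of_emitted(2)[OF em n that] unfolding k(1)
        by (metis (mono_tags, lifting) le_trans of_nat_le_iff of_nat_mult of_nat_numeral of_nat_power)
      moreover have "outputs_sequence n s (output_sequence n s)"
        using True by (simp add: outputs_sequence_def s_answer)
      ultimately show ?thesis using sequence_of_emitted(1)[OF em n] by blast
    next
      case False
      \<comment> \<open>Fewer than n - 1 merges mean that more than one interval is left. A sequence
        within k would then provide an admissible merge, against \<open>stuck\<close>.\<close>
      have "p (n - 1) \<noteq> 0" using stable_single_interval[OF p(1) _ e n] False by auto
      moreover have div: "division n p" using p(1) by (simp add: stable_def)
      moreover have "0 \<le> p (n - 1)" using division_bounds(1)[OF div, of "n - 1"] n by simp
      ultimately have pos: "0 < p (n - 1)" by simp
      have "k < int (stw M)"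
      proof (rule stw_greater[OF dim n], rule ccontr)
        fix Ps assume seq: "symmetric_partition_sequence n Ps"
          and "\<not> (\<exists>P\<in>set Ps. k < int (stretch_value M P))"
        then have "stretch_value M P \<le> m" if "P \<in> set Ps" for P
          using that unfolding k(1) by (metis not_le of_nat_less_iff)
        from exists_mergeable[OF seq this div pos n] p(2) show False
          by (auto simp: stuck_def)
      qed
      moreover have "reports_large s" using False by (simp add: s_answer reports_large_def)
      ultimately show ?thesis by blast
    qed
  qed
qed

theorem theorem4:
  shows "\<exists>(prog :: com) (a :: nat) (d :: nat) (c :: nat).
    \<forall>(n :: nat) (k :: int) (M :: int mat).
      1 \<le> n \<and> M \<in> carrier_mat n n \<and> transpose_mat M = M \<and> elements_mat M \<subseteq> {0, 1} \<longrightarrow>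
      (\<exists>t s. exec prog (input_state n k M) t s \<and> t \<le> a * n ^ d \<and>
        ((\<exists>Ps. outputs_sequence n s Ps \<and> symmetric_partition_sequence n Ps \<and>
            (\<forall>P\<in>set Ps. int (stretch_value M P) \<le> int c * k ^ 3)) \<or>
         (reports_large s \<and> int (stw M) > k)))"
proof -
  obtain a d where cost: "\<And>n. 1 \<le> n \<Longrightarrow> cost program n \<le> a * n ^ d"
    using cost_polynomial by blast
  show ?thesis
  proof (rule exI[of _ "compile program"], rule exI[of _ a], rule exI[of _ d], rule exI[of _ 30],
      intro allI impI)
    fix n :: nat and k :: int and M :: "int mat"
    assume *: "1 \<le> n \<and> M \<in> carrier_mat n n \<and> transpose_mat M = M \<and> elements_mat M \<subseteq> {0, 1}"
    let ?s = "run program (input_state n k M)"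
    have sym: "\<forall>i<n. \<forall>j<n. M $$ (i, j) = M $$ (j, i)"
      using * by (metis carrier_matD index_transpose_mat(1))
    obtain t where t: "t \<le> cost program n" "exec (compile program) (input_state n k M) t ?s"
      using exec_compile[OF well_formed_program, of "input_state n k M" n] by (auto simp: input_state_def)
    have "t \<le> a * n ^ d" using t(1) cost * by (meson le_trans)
    with t(2) run_program[of n M k] sym * show "\<exists>t s. exec (compile program) (input_state n k M) t s \<and>
        t \<le> a * n ^ d \<and>
        ((\<exists>Ps. outputs_sequence n s Ps \<and> symmetric_partition_sequence n Ps \<and>
            (\<forall>P\<in>set Ps. int (stretch_value M P) \<le> int 30 * k ^ 3)) \<or>
         (reports_large s \<and> int (stw M) > k))"
      by (intro exI[of _ t] exI[of _ ?s]) auto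
  qed
qed

end
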